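(* Let $m$ be an integer such that $q=2m^2+2m+1$ is a prime power, and put $n=2q+2=4(m^2+m+1)$. Then there exists a biregular Hadamard matrix of order $n$ with maximum excess, i.e. whose excess equals the upper bound $n(t+4)-4s$ described in the context. In particular, the Hadamard matrix \[ H=\begin{pmatrix} 1 & -1 & \mathbf{1}_q^{\top} & \mathbf{1}_q^{\top}\\ -1 & -1 & \mathbf{1}_q^{\top} & -\mathbf{1}_q^{\top}\\ \mathbf{1}_q & \mathbf{1}_q & M_1 & M_2\\ \mathbf{1}_q & -\mathbf{1}_q & M_2 & M_3\end{pmatrix} \] can be transformed into a biregular Hadamard matrix with maximum excess by multiplying some of its rows and some of its columns by $-1$. Here $M$ is the $q\times q$ matrix with rows and columns indexed by $\mathbb{F}_q$ and $M_{i,j}=0$ if $j=i$, $M_{i,j}=1$ if $j-i$ is a nonzero square of $\mathbb{F}_q$, $M_{i,j}=-1$ if $j-i$ is a nonsquare; and $M_1=M+I_q$, $M_2=M-I_q$, $M_3=-M_1$.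
   Context: An Hadamard matrix of order $n$ is an $n\times n$ matrix $H$ with entries in $\{1,-1\}$ such that $HH^{\top}=nI_n$. Its excess $E(H)$ is the sum of all its entries. $\mathbf{1}_n$ is the all-one column vector of length $n$. $H$ is called biregular if the entries of $H\mathbf{1}_n$ take exactly two values, both nonnegative integers. Known upper bound on the excess: let $k$ be the even integer with $k\le\sqrt{n}<k+2$; put $t=k$ if $|n-k^2|<|n-(k+2)^2|$ and $t=k-2$ otherwise; let $s$ be the integer part of $n((t+4)^2-n)/(8t+16)$. Then every Hadamard matrix $H$ of order $n$ satisfies $E(H)\le n(t+4)-4s$; "maximum excess" means $E(H)=n(t+4)-4s$. For $q\equiv 1 \pmod 4$ the matrix $H$ in the claim is an Hadamard matrix of order $2q+2$. *)

theory Defs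
  imports
    "Jordan_Normal_Form.Matrix"
    "HOL-Number_Theory.Prime_Powers"
    "HOL-Algebra.Ring"
begin

definition hadamard_mat :: "nat \<Rightarrow> int mat \<Rightarrow> bool" where
  "hadamard_mat n H \<longleftrightarrow>
     H \<in> carrier_mat n n \<and>
     elements_mat H \<subseteq> {1, -1} \<and>
     H * transpose_mat H = int n \<cdot>\<^sub>m 1\<^sub>m n"

definition excess :: "int mat \<Rightarrow> int" where
  "excess H = (\<Sum>i<dim_row H. \<Sum>j<dim_col H. H $$ (i, j))"

definition ones_vec :: "nat \<Rightarrow> int vec" where
  "ones_vec n = vec n (\<lambda>_. 1)"

definition biregular :: "int mat \<Rightarrow> bool" where
  "biregular H \<longleftrightarrow>
     (let S = set\<^sub>v (H *\<^sub>v ones_vec (dim_col H)) in card S = 2 \<and> (\<forall>v\<in>S. 0 \<le> v))"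

definition excess_k :: "nat \<Rightarrow> int" where
  "excess_k n = (THE k. even k \<and> real_of_int k \<le> sqrt (real n) \<and> sqrt (real n) < real_of_int (k + 2))"

definition excess_t :: "nat \<Rightarrow> int" where
  "excess_t n =
     (let k = excess_k n
      in if \<bar>int n - k\<^sup>2\<bar> < \<bar>int n - (k + 2)\<^sup>2\<bar> then k else k - 2)"

definition excess_s :: "nat \<Rightarrow> int" where
  "excess_s n =
     (let t = excess_t n
      in \<lfloor>real_of_int (int n * ((t + 4)\<^sup>2 - int n)) / real_of_int (8 * t + 16)\<rfloor>)"

definition excess_bound :: "nat \<Rightarrow> int" where
  "excess_bound n = int n * (excess_t n + 4) - 4 * excess_s n"

definition max_excess :: "nat \<Rightarrow> int mat \<Rightarrow> bool" where
  "max_excess n H \<longleftrightarrow> excess H = excess_bound n"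

definition negate_rows_cols :: "nat set \<Rightarrow> nat set \<Rightarrow> int mat \<Rightarrow> int mat" where
  "negate_rows_cols R C H =
     mat (dim_row H) (dim_col H)
       (\<lambda>(i, j). (if i \<in> R then -1 else 1) * (if j \<in> C then -1 else 1) * H $$ (i, j))"

definition nonzero_square :: "('a, 'b) ring_scheme \<Rightarrow> 'a \<Rightarrow> bool" where
  "nonzero_square F x \<longleftrightarrow> x \<noteq> \<zero>\<^bsub>F\<^esub> \<and> (\<exists>y\<in>carrier F. x = y \<otimes>\<^bsub>F\<^esub> y)"

text \<open>
  Rows and columns indexed by the field are realised through one enumeration
  \<open>e\<close> of its carrier by \<open>{0..<q}\<close>, used for both rows and columns.
\<close>

definition paley_mat :: "('a, 'b) ring_scheme \<Rightarrow> nat \<Rightarrow> (nat \<Rightarrow> 'a) \<Rightarrow> int mat" where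
  "paley_mat F q e = mat q q (\<lambda>(i, j).
     if e j = e i then 0
     else if nonzero_square F (e j \<ominus>\<^bsub>F\<^esub> e i) then 1
     else -1)"

definition ones_mat :: "nat \<Rightarrow> nat \<Rightarrow> int mat" where
  "ones_mat r c = mat r c (\<lambda>_. 1)"

definition paley_hadamard :: "('a, 'b) ring_scheme \<Rightarrow> nat \<Rightarrow> (nat \<Rightarrow> 'a) \<Rightarrow> int mat" where
  "paley_hadamard F q e =
     (let M = paley_mat F q e;
          M1 = M + 1\<^sub>m q;
          M2 = M - 1\<^sub>m q;
          M3 = - M1;
          r = ones_mat 1 q;
          c = ones_mat q 1
      in four_block_mat
           (mat_of_rows_list 2 [[1, -1], [-1, -1]])
           (four_block_mat r r r (- r))
           (four_block_mat c c c (- c))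
           (four_block_mat M1 M2 M2 M3))"

end

theory Submission
  imports Defs "HOL-Algebra.Algebraic_Closure" "HOL-Number_Theory.Residues"
begin

text \<open>
  Let \<open>C\<close> be the symmetric Paley conference matrix on the projective line over the field with
  \<open>q\<close> elements. Then \<open>H\<close> is \<open>C\<close> tensored with \<open>(1, 1; 1, -1)\<close> plus the identity tensored with
  \<open>(1, -1; -1, -1)\<close>. Let \<open>\<chi>\<close> be a quartic character and \<open>g\<close> a nonsquare, and put \<open>w(\<infinity>) = 1\<close>,
  \<open>w(x) = \<chi>(x\<^sup>2 - g)\<close>, a vector with entries in \<open>{1, i, -1, -i}\<close>. The stabiliser of the
  anisotropic form \<open>x\<^sup>2 - g y\<^sup>2\<close> acts transitively on the projective line, which gives
  \<open>C w = J (cnj w)\<close> with \<open>J = A + i B\<close> a Gaussian integer of norm \<open>q\<close>. Negating columns according to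
  \<open>w = u + i v\<close> (signs \<open>u + v\<close> and \<open>u - v\<close> on the two copies) makes all row sums equal to
  \<open>\<plusminus>2A\<close> or \<open>\<plusminus>2(B \<plusminus> 1)\<close>. Reducing \<open>J\<close> modulo \<open>p\<close> shows that \<open>p\<close> does not divide it, so
  \<open>q = A\<^sup>2 + B\<^sup>2 = m\<^sup>2 + (m + 1)\<^sup>2\<close> are two proper representations of a prime power and
  \<open>{|A|, |B|} = {m, m + 1}\<close>. Hence only two absolute row sums occur, either \<open>2m, 2m + 4\<close> or
  \<open>2m - 2, 2m + 2\<close>, and since the squares of the row sums add up to \<open>n\<^sup>2\<close>, the excess is
  \<open>n (2m + 1)\<close>, which is the bound.
\<close>

hide_const (open) Divisibility.prime

section \<open>Prime powers as sums of two squares\<close>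

text \<open>The multiples of \<open>p\<close> up to \<open>n\<close> are
  \<open>p * 1, ..., p * (n div p)\<close>; taking one factor \<open>p\<close> out of each leaves
  the factorial of \<open>n div p\<close>.\<close>

lemma multiplicity_fact_div:
  fixes p :: nat
  assumes "prime p"
  shows "multiplicity p (fact n :: nat) = n div p + multiplicity p (fact (n div p) :: nat)"
proof (induction n)
  case 0
  show ?case by simp
next
  case (Suc n)
  have p: "prime_elem p" "p > 1" using assms prime_gt_1_nat by auto
  have step: "multiplicity p (fact (Suc m) :: nat)
      = multiplicity p (Suc m) + multiplicity p (fact m :: nat)" for m
    unfolding fact_Suc of_nat_id
    by (rule prime_elem_multiplicity_mult_distrib[OF p(1)]) auto
  show ?case
  proof (cases "p dvd Suc n")
    case True
    then obtain j where j: "Suc n = p * j" by (elim dvdE)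
    with p have "j > 0" by (cases j) auto
    then obtain i where i: "j = Suc i" by (cases j) auto
    have "n div p = i" using j i p
      by (intro div_nat_eqI) auto
    moreover have "Suc n div p = Suc i" using j i p by simp
    moreover have "multiplicity p (Suc n) = Suc (multiplicity p (Suc i))"
      unfolding j i using p by (subst multiplicity_times_same) auto
    ultimately show ?thesis using Suc.IH step[of n] step[of i] by simp
  next
    case False
    then have "Suc n div p = n div p" by (simp add: div_Suc dvd_eq_mod_eq_0)
    moreover have "multiplicity p (Suc n) = 0" using False by (rule not_dvd_imp_multiplicity_0)
    ultimately show ?thesis using Suc.IH step[of n] by simp
  qed
qed

text \<open>All base \<open>p\<close> digits of \<open>N\<close> equal
  \<open>r = (p - 1) / 4\<close>, so adding \<open>2 * N\<close> and \<open>N\<close> produces no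
  carry, and Kummer's criterion applies. Concretely \<open>N = p * M + r\<close> with
  \<open>c * r < p\<close> for \<open>c \<le> 3\<close>, so each Legendre step replaces
  \<open>c * N\<close> by \<open>c * M\<close> and the contributions
  \<open>3 * M = 2 * M + M\<close> balance.\<close>

lemma prime_not_dvd_choose_quarters:
  fixes p k N :: nat
  assumes p: "prime p" "p mod 4 = 1" and N: "4 * N + 1 = p ^ k"
  shows "\<not> p dvd (3 * N choose (2 * N))"
proof -
  have "multiplicity p (fact (3 * N) :: nat)
      = multiplicity p (fact (2 * N) :: nat) + multiplicity p (fact N :: nat)"
    using N
  proof (induction k arbitrary: N)
    case 0
    then show ?case by simp
  next
    case (Suc k)
    obtain r where r: "p = 4 * r + 1" using p(2) by (metis mult_div_mod_eq)
    have "p ^ k mod 4 = 1" using p(2) by (metis mod_mod_trivial power_mod power_one)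
    then obtain M where M: "p ^ k = 4 * M + 1" by (metis mult_div_mod_eq)
    have N: "N = p * M + r"
    proof -
      have "4 * N + 1 = p * (4 * M + 1)" using Suc.prems M by simp
      also have "\<dots> = 4 * (p * M) + p" by (simp add: algebra_simps)
      finally show ?thesis using r by simp
    qed
    have div: "(c * N) div p = c * M" if "c \<le> 3" for c
    proof -
      have "c * N = c * r + p * (c * M)" by (simp add: N algebra_simps)
      moreover have "c * r < p"
        using that mult_le_mono1[OF that, of r] r by linarith
      moreover have "p \<noteq> 0" using r by simp
      ultimately show ?thesis by simp
    qed
    have "multiplicity p (fact (c * N) :: nat) = c * M + multiplicity p (fact (c * M) :: nat)"
      if "c \<le> 3" for c
      using multiplicity_fact_div[OF p(1), of "c * N"] div[OF that] by simp
    from this[of 1] this[of 2] this[of 3] Suc.IH[of M] M show ?case by simp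
  qed
  moreover have "multiplicity p (fact (3 * N) :: nat)
      = multiplicity p (fact (2 * N) :: nat) + multiplicity p (fact N :: nat)
        + multiplicity p (3 * N choose (2 * N))"
  proof -
    have "(fact (3 * N) :: nat) = (fact (2 * N) * fact N) * (3 * N choose (2 * N))"
      using binomial_fact_lemma[of "2 * N" "3 * N"] by simp
    moreover have "prime_elem p" using p by simp
    ultimately show ?thesis
      by (simp add: prime_elem_multiplicity_mult_distrib)
  qed
  ultimately have "multiplicity p (3 * N choose (2 * N)) = 0" by linarith
  moreover have "(3 * N choose (2 * N)) \<noteq> 0" by simp
  ultimately show ?thesis
    using p(1) by (metis multiplicity_eq_zero_iff not_prime_unit)
qed

section \<open>Residues and uniqueness for sums of two squares\<close>

text \<open>For \<open>p\<close> congruent to 3 modulo 4 the exponent \<open>h = (p - 1) / 2\<close>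
  is odd. Raising \<open>a^2 = - b^2\<close> to the power \<open>h\<close> and applying Fermat's
  theorem to both sides would give \<open>1 = -1\<close> modulo \<open>p\<close>.\<close>

lemma prime_dvd_sum_squares_mod_4:
  fixes p :: nat and a b :: int
  assumes p: "prime p" "odd p" and "int p dvd a\<^sup>2 + b\<^sup>2" and "\<not> int p dvd a"
  shows "p mod 4 = 1"
proof (rule ccontr)
  assume "p mod 4 \<noteq> 1"
  with p(2) have p3: "p mod 4 = 3" by presburger
  define h where "h = (p - 1) div 2"
  have h: "p - 1 = 2 * h" "odd h" using p3 unfolding h_def by presburger+
  have ab: "[a\<^sup>2 = - b\<^sup>2] (mod int p)"
    using assms(3) by (simp add: cong_iff_dvd_diff)
  have nb: "\<not> int p dvd b"
  proof
    assume "int p dvd b"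
    then have "int p dvd b\<^sup>2" by (simp add: power2_eq_square)
    with assms(3) have "int p dvd a\<^sup>2" by (simp add: dvd_add_left_iff)
    with assms(4) p(1) show False by (meson prime_dvd_power prime_nat_int_transfer)
  qed
  have "[(a\<^sup>2) ^ h = (- b\<^sup>2) ^ h] (mod int p)" by (rule cong_pow[OF ab])
  moreover have "(- b\<^sup>2) ^ h = - (b ^ (p - 1))" using h
    by (simp add: power_mult)
  moreover have "(a\<^sup>2) ^ h = a ^ (p - 1)" using h by (simp add: power_mult)
  ultimately have *: "[a ^ (p - 1) = - (b ^ (p - 1))] (mod int p)" by simp
  have F: "[x ^ (p - 1) = 1] (mod int p)" if "\<not> int p dvd x" for x :: int
  proof -
    have "\<not> p dvd nat \<bar>x\<bar>" using that by (metis abs_ge_zero dvd_abs_iff int_dvd_int_iff nat_0_le)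
    then have "[nat \<bar>x\<bar> ^ (p - 1) = 1] (mod p)" by (rule fermat_theorem[OF p(1)])
    then have "[int (nat \<bar>x\<bar> ^ (p - 1)) = int 1] (mod int p)" by (simp only: cong_int_iff)
    moreover have "\<bar>x\<bar> ^ (p - 1) = x ^ (p - 1)" using h by (simp add: power_mult)
    ultimately show ?thesis by simp
  qed
  have "[(1::int) = - 1] (mod int p)"
    using * F[OF assms(4)] F[OF nb] by (meson cong_minus_minus_iff cong_sym cong_trans)
  then have "int p dvd 2" by (simp add: cong_iff_dvd_diff)
  then have "p \<le> 2" by (metis int_dvd_int_iff of_nat_numeral dvd_imp_le zero_less_numeral)
  with p3 show False by (cases p rule: nat.exhaust) (auto simp: le_Suc_eq)
qed

text \<open>With \<open>q = p^k\<close> one has \<open>(ad - bc)(ad + bc) = q (a^2 - c^2)\<close>.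
  The prime \<open>p\<close> cannot divide both factors, since it would then divide
  \<open>2ad\<close>; hence \<open>q\<close> divides one factor entirely. The two-square identity
  for \<open>q^2\<close> then makes the pairs proportional, and having the same norm they agree up
  to sign and order.\<close>

lemma sum_squares_prime_power_unique:
  fixes p k :: nat and a b c d :: int
  assumes p: "prime p" "odd p"
    and q: "int p ^ k = a\<^sup>2 + b\<^sup>2" "int p ^ k = c\<^sup>2 + d\<^sup>2"
    and cop: "coprime c d"
    and nd: "\<not> (int p dvd a \<and> int p dvd b)"
  shows "(\<bar>a\<bar> = \<bar>c\<bar> \<and> \<bar>b\<bar> = \<bar>d\<bar>) \<or> (\<bar>a\<bar> = \<bar>d\<bar> \<and> \<bar>b\<bar> = \<bar>c\<bar>)"
proof (cases "k = 0")
  case True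
  have *: "(\<bar>x\<bar> = 1 \<and> y = 0) \<or> (x = 0 \<and> \<bar>y\<bar> = 1)" if "x\<^sup>2 + y\<^sup>2 = 1" for x y :: int
  proof -
    have "x\<^sup>2 \<le> 1\<^sup>2" "y\<^sup>2 \<le> 1\<^sup>2"
      using that zero_le_power2[of x] zero_le_power2[of y] unfolding power_one by linarith+
    then have "\<bar>x\<bar> \<le> 1" "\<bar>y\<bar> \<le> 1"
      unfolding abs_le_square_iff[symmetric] by simp_all
    then have "x \<in> {-1,0,1}" "y \<in> {-1,0,1}" by auto
    then show ?thesis using that by auto
  qed
  show ?thesis using *[of a b] *[of c d] q True by auto
next
  case False
  let ?q = "int p ^ k"
  have pp: "prime (int p)" using p by simp
  have pq: "int p dvd ?q" using False by simp
  have q0: "?q > 0" using p(1) by (simp add: prime_gt_0_nat)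
  have sq: "int p dvd x \<longleftrightarrow> int p dvd y" if "?q = x\<^sup>2 + y\<^sup>2" for x y :: int
  proof -
    have "int p dvd x\<^sup>2 \<longleftrightarrow> int p dvd y\<^sup>2"
      using that pq by (metis dvd_add_right_iff dvd_add_left_iff)
    then show ?thesis using pp by (simp add: prime_dvd_power_iff)
  qed
  have na: "\<not> int p dvd a" "\<not> int p dvd b" using nd sq[OF q(1)] by auto
  have nc: "\<not> int p dvd c" "\<not> int p dvd d"
    using cop sq[OF q(2)] pp by (meson coprime_def not_prime_unit)+
  have "(a * d - b * c) * (a * d + b * c) = a\<^sup>2 * (c\<^sup>2 + d\<^sup>2) - c\<^sup>2 * (a\<^sup>2 + b\<^sup>2)"
    by (simp add: power2_eq_square algebra_simps)
  then have "(a * d - b * c) * (a * d + b * c) = ?q * (a\<^sup>2 - c\<^sup>2)"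
    unfolding q(1)[symmetric] q(2)[symmetric] by (simp add: algebra_simps)
  then have dv: "?q dvd (a * d - b * c) * (a * d + b * c)" by simp
  \<comment> \<open>The sign \<open>s\<close> treats the two factors \<open>ad - bc\<close> and
    \<open>ad + bc\<close> together.\<close>
  have main: "(\<bar>a\<bar> = \<bar>c\<bar> \<and> \<bar>b\<bar> = \<bar>d\<bar>) \<or> (\<bar>a\<bar> = \<bar>d\<bar> \<and> \<bar>b\<bar> = \<bar>c\<bar>)"
    if dvds: "?q dvd a * d - s * b * c" and s2: "s\<^sup>2 = 1" for s :: int
  proof -
    have q2: "?q\<^sup>2 = (a * d - s * b * c)\<^sup>2 + (a * c + s * b * d)\<^sup>2"
    proof -
      have "?q\<^sup>2 = (a\<^sup>2 + b\<^sup>2) * (c\<^sup>2 + d\<^sup>2)" using q by (simp add: power2_eq_square)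
      also have "\<dots> = (a * d)\<^sup>2 + (a * c)\<^sup>2 + s\<^sup>2 * (b * c)\<^sup>2 + s\<^sup>2 * (b * d)\<^sup>2" 
        by (simp add: s2 power_mult_distrib algebra_simps)
      also have "\<dots> = (a * d - s * b * c)\<^sup>2 + (a * c + s * b * d)\<^sup>2"
        by (simp add: power2_eq_square algebra_simps)
      finally show ?thesis .
    qed
    have s: "\<bar>s\<bar> = 1" using s2 by (auto simp: power2_eq_1_iff)
    \<comment> \<open>The quotient satisfies \<open>\<bar>e\<bar> \<le> 1\<close>: either the first
      square in \<open>q2\<close> is zero, or it exhausts \<open>q^2\<close> and the second square
      is zero.\<close>
    obtain e where e: "a * d - s * b * c = ?q * e" using dvds by (elim dvdE)
    have "(?q * e)\<^sup>2 \<le> ?q\<^sup>2" using q2 zero_le_power2[of "a * c + s * b * d"] unfolding e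
      by linarith
    then have "\<bar>?q * e\<bar> \<le> \<bar>?q\<bar>" by (simp only: abs_le_square_iff)
    then have "?q * \<bar>e\<bar> \<le> ?q * 1" using q0 by (simp add: abs_mult)
    then have "\<bar>e\<bar> \<le> 1" using q0 by (simp only: mult_le_cancel_left_pos)
    then have "e = 0 \<or> e\<^sup>2 = 1" by (auto simp: power2_eq_1_iff)
    then have "a * d = s * b * c \<or> a * c = - s * b * d"
    proof
      assume "e\<^sup>2 = 1"
      then have "(a * c + s * b * d)\<^sup>2 = 0" using q2 unfolding e by (simp add: power_mult_distrib)
      then show ?thesis by simp
    qed (use e in simp)
    then have abs: "\<bar>a\<bar> * \<bar>d\<bar> = \<bar>b\<bar> * \<bar>c\<bar> \<or> \<bar>a\<bar> * \<bar>c\<bar> = \<bar>b\<bar> * \<bar>d\<bar>"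
    proof
      assume "a * d = s * b * c"
      then have "\<bar>a * d\<bar> = \<bar>s * b * c\<bar>" by simp
      then show ?thesis using s by (simp add: abs_mult)
    next
      assume "a * c = - s * b * d"
      then have "\<bar>a * c\<bar> = \<bar>- s * b * d\<bar>" by simp
      then show ?thesis using s by (simp add: abs_mult)
    qed
    have fin: "\<bar>a\<bar> = \<bar>x\<bar> \<and> \<bar>b\<bar> = \<bar>y\<bar>"
      if eq: "\<bar>a\<bar> * \<bar>y\<bar> = \<bar>b\<bar> * \<bar>x\<bar>" and xy: "?q = x\<^sup>2 + y\<^sup>2" for x y :: int
    proof -
      have "(a * y)\<^sup>2 = (b * x)\<^sup>2" using eq by (metis abs_mult power2_abs)
      then have "a\<^sup>2 * (x\<^sup>2 + y\<^sup>2) = x\<^sup>2 * (a\<^sup>2 + b\<^sup>2)"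
        by (simp add: power_mult_distrib algebra_simps)
      then have "a\<^sup>2 * ?q = x\<^sup>2 * ?q" by (simp only: q(1)[symmetric] xy[symmetric])
      then have "a\<^sup>2 = x\<^sup>2" using q0 by auto
      moreover have "b\<^sup>2 = y\<^sup>2" using calculation q(1) xy by simp
      ultimately show ?thesis by (simp add: power2_eq_iff abs_eq_iff)
    qed
    have "?q = d\<^sup>2 + c\<^sup>2" using q(2) by linarith
    then show ?thesis using abs fin[of d c] fin[of c d] q(2) by blast
  qed
  have "\<not> (int p dvd a * d - b * c \<and> int p dvd a * d + b * c)"
  proof
    assume h: "int p dvd a * d - b * c \<and> int p dvd a * d + b * c"
    then have "int p dvd (a * d - b * c) + (a * d + b * c)" by (meson dvd_add)
    then have "int p dvd 2 * (a * d)" by simp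
    moreover have "\<not> int p dvd 2"
    proof
      assume "int p dvd 2"
      then have "p dvd 2" by (metis int_dvd_int_iff of_nat_numeral)
      then have "p = 2" using p(1) primes_dvd_imp_eq two_is_prime_nat by blast
      then show False using p(2) by simp
    qed
    ultimately show False using pp na nc by (simp add: prime_dvd_mult_iff)
  qed
  then consider "\<not> int p dvd a * d - b * c" | "\<not> int p dvd a * d + b * c" by blast
  then have "?q dvd a * d + b * c \<or> ?q dvd a * d - b * c"
  proof cases
    case 1
    then have "coprime ?q (a * d - b * c)" using pp by (simp add: prime_imp_coprime)
    then show ?thesis using dv by (simp add: coprime_dvd_mult_right_iff)
  next
    case 2
    then have "coprime ?q (a * d + b * c)" using pp by (simp add: prime_imp_coprime)
    then show ?thesis using dv by (simp add: coprime_dvd_mult_left_iff)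
  qed
  then show ?thesis
  proof
    assume "?q dvd a * d + b * c"
    then show ?thesis using main[of "- 1"] by simp
  next
    assume "?q dvd a * d - b * c"
    then show ?thesis using main[of 1] by simp
  qed
qed

section \<open>Existence of finite fields\<close>

lemma (in cring) binomial_expansion:
  assumes a: "a \<in> carrier R" and b: "b \<in> carrier R"
  shows "(a \<oplus> b) [^] (n::nat) = (\<Oplus>k\<in>{..n}. add_pow R (n choose k) (a [^] k \<otimes> b [^] (n - k)))"
proof (induction n)
  case 0
  show ?case using assms by simp
next
  case (Suc n)
  let ?t = "\<lambda>c i j. add_pow R (c::nat) (a [^] (i::nat) \<otimes> b [^] (j::nat))"
  have tc [simp]: "?t c i j \<in> carrier R" for c i j using assms by simp
  have A: "(\<Oplus>k\<in>{..n}. ?t (n choose k) k (n - k)) \<otimes> a = (\<Oplus>k\<in>{..n}. ?t (n choose k) (Suc k) (n - k))"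
  proof -
    have "?t c i j \<otimes> a = ?t c (Suc i) j" for c i j
      using assms by (subst add_pow_ldistr) (auto simp: m_ac)
    then show ?thesis using assms by (subst finsum_ldistr) (auto intro!: finsum_cong')
  qed
  have B: "(\<Oplus>k\<in>{..n}. ?t (n choose k) k (n - k)) \<otimes> b
      = (\<Oplus>k\<in>{..n}. ?t (n choose k) k (Suc n - k))"
  proof -
    have "?t c i j \<otimes> b = ?t c i (Suc j)" for c i j
      using assms by (subst add_pow_ldistr) (auto simp: m_ac)
    then show ?thesis using assms
      by (subst finsum_ldistr) (auto intro!: finsum_cong' simp: Suc_diff_le)
  qed
  \<comment> \<open>The sum is extended by its term at \<open>k = Suc n\<close>, which vanishes, and
    then the term at \<open>k = 0\<close> is split off. The shifted remainder can be merged with the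
    sum in \<open>A\<close> by Pascal's rule.\<close>
  have C: "(\<Oplus>k\<in>{..n}. ?t (n choose k) k (Suc n - k))
      = (\<Oplus>k\<in>{..n}. ?t (n choose Suc k) (Suc k) (n - k)) \<oplus> ?t 1 0 (Suc n)"
  proof -
    have "(\<Oplus>k\<in>{..Suc n}. ?t (n choose k) k (Suc n - k))
        = (\<Oplus>k\<in>{..n}. ?t (n choose Suc k) (Suc k) (n - k)) \<oplus> ?t 1 0 (Suc n)"
      by (subst finsum_Suc2) auto
    moreover have "(\<Oplus>k\<in>{..Suc n}. ?t (n choose k) k (Suc n - k))
        = (\<Oplus>k\<in>{..n}. ?t (n choose k) k (Suc n - k))"
      by (subst finsum_Suc) (auto simp: binomial_eq_0)
    ultimately show ?thesis by simp
  qed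
  have "(a \<oplus> b) [^] Suc n = (\<Oplus>k\<in>{..n}. ?t (n choose k) k (n - k)) \<otimes> (a \<oplus> b)"
    using Suc.IH by simp
  also have "\<dots> = (\<Oplus>k\<in>{..n}. ?t (n choose k) (Suc k) (n - k))
      \<oplus> ((\<Oplus>k\<in>{..n}. ?t (n choose Suc k) (Suc k) (n - k)) \<oplus> ?t 1 0 (Suc n))"
    using assms by (subst r_distr) (simp_all add: A B C)
  also have "\<dots> = (\<Oplus>k\<in>{..n}. ?t (n choose k) (Suc k) (n - k) \<oplus> ?t (n choose Suc k) (Suc k) (n - k))
      \<oplus> ?t 1 0 (Suc n)"
    using assms by (subst finsum_addf) (auto simp: a_assoc)
  also have "(\<Oplus>k\<in>{..n}. ?t (n choose k) (Suc k) (n - k) \<oplus> ?t (n choose Suc k) (Suc k) (n - k))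
      = (\<Oplus>k\<in>{..n}. ?t (Suc n choose Suc k) (Suc k) (n - k))"
    using assms by (intro finsum_cong') (auto simp: add.nat_pow_mult)
  also have "\<dots> \<oplus> ?t 1 0 (Suc n) = (\<Oplus>k\<in>{..Suc n}. ?t (Suc n choose k) k (Suc n - k))"
    by (subst finsum_Suc2) auto
  finally show ?case .
qed

lemma (in cring) add_pow_multiple_of_char:
  assumes "add_pow R (p::nat) \<one> = \<zero>" "x \<in> carrier R" "p dvd n"
  shows "add_pow R n x = \<zero>"
proof -
  obtain j where j: "n = p * j" using assms(3) by (elim dvdE)
  have "add_pow R p x = add_pow R p \<one> \<otimes> x" using assms(2) by (subst add_pow_ldistr) auto
  then have "add_pow R p x = \<zero>" using assms by simp
  then show ?thesis using assms(2) unfolding j by (simp add: add.nat_pow_pow[symmetric])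
qed

lemma (in cring) freshmans_dream:
  assumes p: "prime p" "add_pow R (p::nat) \<one> = \<zero>"
    and a: "a \<in> carrier R" and b: "b \<in> carrier R"
  shows "(a \<oplus> b) [^] p = a [^] p \<oplus> b [^] p"
proof -
  \<comment> \<open>This form of \<open>p\<close> lets both end terms of the expansion be split off;
    the inner indices are \<open>Suc k\<close> with \<open>k \<le> s\<close>, where \<open>p\<close>
    divides the coefficient.\<close>
  obtain s where s: "p = Suc (Suc s)"
    using prime_ge_2_nat[OF p(1)] by (metis add_2_eq_Suc le_Suc_ex)
  let ?f = "\<lambda>k. add_pow R (p choose k) (a [^] k \<otimes> b [^] (p - k))"
  have f: "?f k \<in> carrier R" for k using a b by simp
  have "(a \<oplus> b) [^] p = (\<Oplus>k\<in>{..Suc (Suc s)}. ?f k)"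
    using binomial_expansion[OF a b, of p] s by simp
  also have "\<dots> = ?f p \<oplus> ((\<Oplus>k\<in>{..s}. ?f (Suc k)) \<oplus> ?f 0)"
    using f unfolding s by (subst finsum_Suc, blast, subst finsum_Suc2) auto
  also have "(\<Oplus>k\<in>{..s}. ?f (Suc k)) = \<zero>"
  proof (rule add.finprod_one_eqI)
    fix k assume "k \<in> {..s}"
    then have "p dvd (p choose Suc k)" using s p(1) by (intro dvd_choose_prime) auto
    then show "?f (Suc k) = \<zero>" using a b by (intro add_pow_multiple_of_char[OF p(2)]) auto
  qed
  finally show ?thesis using a b by simp
qed

lemma (in cring) freshmans_dream_power:
  assumes p: "prime p" "add_pow R (p::nat) \<one> = \<zero>"
    and a: "a \<in> carrier R" and b: "b \<in> carrier R"
  shows "(a \<oplus> b) [^] (p ^ k) = a [^] (p ^ k) \<oplus> b [^] (p ^ k)"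
proof (induction k)
  case 0
  show ?case using a b by simp
next
  case (Suc k)
  have *: "x [^] (p ^ Suc k) = (x [^] (p ^ k)) [^] p" if "x \<in> carrier R" for x
    using that by (simp add: nat_pow_pow mult.commute)
  show ?case using a b Suc.IH freshmans_dream[OF p, of "a [^] (p ^ k)" "b [^] (p ^ k)"]
    by (simp only: * a_closed) simp
qed

text \<open>Additivity of the \<open>p^k\<close>-th power applied to \<open>- a + a = 0\<close>. No
  distinction between odd and even \<open>p\<close> arises.\<close>

lemma (in cring) minus_power_char:
  assumes p: "prime p" "add_pow R (p::nat) \<one> = \<zero>" and a: "a \<in> carrier R"
  shows "(\<ominus> a) [^] (p ^ k) = \<ominus> (a [^] (p ^ k))"
proof -
  have "p ^ k \<noteq> 0" using p(1) by auto
  then have "\<zero> [^] (p ^ k) = \<zero>" by (simp add: nat_pow_zero)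
  then have "(\<ominus> a) [^] (p ^ k) \<oplus> a [^] (p ^ k) = \<zero>"
    using freshmans_dream_power[OF p, of "\<ominus> a" a k] a by (simp add: l_neg)
  then show ?thesis using a by (simp add: minus_equality)
qed

text \<open>Serves in the polynomial ring, with \<open>a = X^q\<close>, \<open>b = X\<close> and
  \<open>c\<close> a constant.\<close>

lemma (in cring) minus_minus_cancel_left:
  assumes "a \<in> carrier R" "b \<in> carrier R" "c \<in> carrier R"
  shows "(a \<ominus> c) \<ominus> (a \<ominus> b) = b \<ominus> c"
  using assms by algebra

text \<open>Carries the relation \<open>p = 0\<close> from a field to its polynomial ring and to its
  algebraic closure.\<close>

lemma ring_hom_char:
  assumes "ring R" "ring S" "h \<in> ring_hom R S"
    and "add_pow R (p::nat) \<one>\<^bsub>R\<^esub> = \<zero>\<^bsub>R\<^esub>"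
  shows "add_pow S p \<one>\<^bsub>S\<^esub> = \<zero>\<^bsub>S\<^esub>"
proof -
  interpret ring_hom_ring R S h using assms by (intro ring_hom_ringI2)
  have "h (add_pow R n \<one>\<^bsub>R\<^esub>) = add_pow S n \<one>\<^bsub>S\<^esub>" for n :: nat
    by (induction n) auto
  from this[of p] assms(4) show ?thesis by simp
qed

section \<open>Finite fields as fixed points of a power of Frobenius\<close>

text \<open>The fixed points are the roots of \<open>P = X^q - X\<close>, which splits, so it
  remains to exclude multiple roots. For a root \<open>a\<close> put \<open>Y = X - a\<close>; then
  \<open>Y^q = X^q - a\<close> and \<open>Y = Y^q - P\<close>. If \<open>Y^2\<close> divided
  \<open>P\<close> it would divide \<open>Y\<close>, against the degrees.\<close>

lemma (in algebraically_closed) card_frobenius_fixed: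
  assumes p: "prime p" "add_pow L (p::nat) \<one> = \<zero>" and k: "k > 0"
  shows "card {x \<in> carrier L. x [^] (p ^ k) = x} = p ^ k"
proof -
  define q where "q = p ^ k"
  have q2: "q \<ge> 2" using prime_ge_2_nat[OF p(1)] k unfolding q_def
    by (metis One_nat_def Suc_leI le_trans power_increasing power_one_right prime_gt_0_nat p(1))
  let ?P = "poly_ring L"
  interpret UP: domain ?P using univ_poly_is_domain[OF carrier_is_subring] .
  interpret em: ring_hom_ring L ?P poly_of_const
    using canonical_embedding_is_hom[OF carrier_is_subring] UP.ring_axioms ring_axioms
    by (intro ring_hom_ringI2) auto
  have char: "add_pow ?P p \<one>\<^bsub>?P\<^esub> = \<zero>\<^bsub>?P\<^esub>"
    by (rule ring_hom_char[OF ring_axioms UP.ring_axioms em.homh p(2)])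
  have X: "X \<in> carrier ?P" by (rule var_closed(1)[OF carrier_is_subring])
  define P where "P = X [^]\<^bsub>?P\<^esub> q \<ominus>\<^bsub>?P\<^esub> X"
  have P: "P \<in> carrier ?P" using X by (simp add: P_def)
  have dX: "degree X = 1" by (simp add: var_def)
  have dP: "degree P = q"
  proof -
    have "degree (X [^]\<^bsub>?P\<^esub> q) = q" using polynomial_pow_degree[OF X] dX by simp
    moreover have "degree (\<ominus>\<^bsub>?P\<^esub> X) = 1"
      using univ_poly_a_inv_degree[OF carrier_is_subring X] dX by simp
    moreover have "polynomial (carrier L) (X [^]\<^bsub>?P\<^esub> q)" "polynomial (carrier L) (\<ominus>\<^bsub>?P\<^esub> X)"
      using X by (auto simp: univ_poly_carrier)
    ultimately show ?thesis unfolding P_def a_minus_def univ_poly_add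
      using poly_add_degree_eq[OF carrier_is_subring, of "X [^]\<^bsub>?P\<^esub> q" "\<ominus>\<^bsub>?P\<^esub> X"] q2 by simp
  qed
  then have Pne: "P \<noteq> []" using q2 by auto
  have evP: "eval P a = a [^] q \<ominus> a" if a: "a \<in> carrier L" for a
  proof -
    interpret ev: ring_hom_ring ?P L "\<lambda>p. eval p a"
      using eval_is_hom[OF carrier_is_subring a] UP.ring_axioms ring_axioms by (intro ring_hom_ringI2)
    have "eval X a = a" using a by (simp add: var_def)
    then show ?thesis using X a unfolding P_def by (simp add: a_minus_def ev.hom_nat_pow)
  qed
  have root: "is_root P a \<longleftrightarrow> a \<in> carrier L \<and> a [^] q = a" for a
    using Pne evP unfolding is_root_def by auto
  have mult: "count (roots P) a \<le> 1" for a
  proof (rule ccontr)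
    assume "\<not> count (roots P) a \<le> 1"
    then have am: "2 \<le> alg_mult P a" by (simp add: alg_mult_eq_count_roots[OF P])
    then have "is_root P a" using alg_mult_gt_zero_iff_is_root[OF P, of a] by simp
    then have a: "a \<in> carrier L" "a [^] q = a" using root by auto
    define Y where "Y = [\<one>, \<ominus> a]"
    have Y: "Y \<in> carrier ?P" using a unfolding Y_def
      by (auto simp: univ_poly_carrier[symmetric] polynomial_def)
    let ?c = "poly_of_const a"
    have c: "?c \<in> carrier ?P" using a by simp
    have cq: "?c [^]\<^bsub>?P\<^esub> q = ?c" using a em.hom_nat_pow[of a q] by simp
    have XY: "Y = X \<ominus>\<^bsub>?P\<^esub> ?c"
    proof -
      have "Y = X \<oplus>\<^bsub>?P\<^esub> poly_of_const (\<ominus> a)"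
        using a unfolding Y_def var_def univ_poly_add poly_of_const_def by simp
      then show ?thesis using a by (simp add: a_minus_def)
    qed
    have "Y [^]\<^bsub>?P\<^esub> q = X [^]\<^bsub>?P\<^esub> q \<ominus>\<^bsub>?P\<^esub> ?c"
      using UP.freshmans_dream_power[OF p(1) char X, of "\<ominus>\<^bsub>?P\<^esub> ?c" k]
        UP.minus_power_char[OF p(1) char c, of k] c cq unfolding XY q_def[symmetric]
      by (simp add: a_minus_def)
    then have YP: "Y = Y [^]\<^bsub>?P\<^esub> q \<ominus>\<^bsub>?P\<^esub> P"
      using UP.minus_minus_cancel_left[OF UP.nat_pow_closed[OF X] X c, of q] unfolding P_def XY by simp
    have d1: "Y [^]\<^bsub>?P\<^esub> (2::nat) divides\<^bsub>?P\<^esub> Y [^]\<^bsub>?P\<^esub> q"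
      using polynomial_pow_division[OF Y q2] unfolding pdivides_def .
    have d2: "Y [^]\<^bsub>?P\<^esub> (2::nat) divides\<^bsub>?P\<^esub> P"
      using le_alg_mult_imp_pdivides[OF a(1) P am] unfolding pdivides_def Y_def .
    obtain u v where u: "u \<in> carrier ?P" "Y [^]\<^bsub>?P\<^esub> q = Y [^]\<^bsub>?P\<^esub> (2::nat) \<otimes>\<^bsub>?P\<^esub> u"
      and v: "v \<in> carrier ?P" "P = Y [^]\<^bsub>?P\<^esub> (2::nat) \<otimes>\<^bsub>?P\<^esub> v"
      using d1 d2 unfolding factor_def by blast
    have "Y = Y [^]\<^bsub>?P\<^esub> (2::nat) \<otimes>\<^bsub>?P\<^esub> (u \<ominus>\<^bsub>?P\<^esub> v)"
      using YP u v Y by (metis UP.minus_eq UP.r_distr UP.r_minus UP.nat_pow_closed UP.a_inv_closed)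
    then have "Y [^]\<^bsub>?P\<^esub> (2::nat) pdivides Y"
      unfolding pdivides_def factor_def using u v by auto
    then have "degree (Y [^]\<^bsub>?P\<^esub> (2::nat)) \<le> degree Y"
      using pdivides_imp_degree_le[OF carrier_is_subring _ Y] Y by (auto simp: Y_def)
    then show False using polynomial_pow_degree[OF Y, of 2] by (simp add: Y_def)
  qed
  \<comment> \<open>As all multiplicities are at most one, the size of the root multiset counts the
    distinct roots.\<close>
  have "roots P = mset_set (set_mset (roots P))"
  proof (rule multiset_eqI)
    fix a
    have "count (roots P) a = (if a \<in># roots P then 1 else 0)"
      using mult[of a] count_greater_eq_one_iff[of "roots P" a] by (metis count_eq_zero_iff le_antisym)
    then show "count (roots P) a = count (mset_set (set_mset (roots P))) a" by simp
  qed
  then have "size (roots P) = card (set_mset (roots P))" by (metis size_mset_set)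
  moreover have "set_mset (roots P) = {x \<in> carrier L. x [^] q = x}"
    using root roots_mem_iff_is_root[OF P] by auto
  moreover have "size (roots P) = q"
    using roots_over_carrier[OF P] dP unfolding splitted_def by simp
  ultimately show ?thesis unfolding q_def by simp
qed

text \<open>The field is cut out of the algebraic closure of the residue ring modulo
  \<open>p\<close> as the set of solutions of \<open>x^(p^k) = x\<close>; the type displayed is that
  of the elements of this closure.\<close>

lemma exists_finite_field:
  assumes p: "prime (p::nat)" and k: "k > 0"
  shows "\<exists>F :: ((int list \<times> nat) multiset \<Rightarrow> int) ring. field F \<and> card (carrier F) = p ^ k"
proof -
  define R where "R = residue_ring (int p)"
  interpret R: residues_prime p R
    by unfold_locales (use p in \<open>simp_all add: R_def\<close>)
  define L where "L = R.alg_closure"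
  interpret L: algebraic_closure L "R.indexed_const ` carrier R"
    unfolding L_def by (rule R.alg_closureE(1))
  have "add_pow R (order R) \<one>\<^bsub>R\<^esub> = \<zero>\<^bsub>R\<^esub>"
    using R.add.pow_order_eq_1[of "\<one>\<^bsub>R\<^esub>"] by (simp add: order_def)
  moreover have "order R = p" by (simp add: order_def R.res_carrier_eq)
  ultimately have char: "add_pow L p \<one>\<^bsub>L\<^esub> = \<zero>\<^bsub>L\<^esub>"
    using ring_hom_char[OF R.ring_axioms L.ring_axioms, of R.indexed_const p] R.alg_closureE(2)
    unfolding L_def by simp
  define S where "S = {x \<in> carrier L. x [^]\<^bsub>L\<^esub> (p ^ k) = x}"
  have "subring S L"
  proof (rule L.subringI)
    show "\<ominus>\<^bsub>L\<^esub> h \<in> S" if "h \<in> S" for h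
      using that L.minus_power_char[OF p char, of h k] by (simp add: S_def)
    show "h1 \<otimes>\<^bsub>L\<^esub> h2 \<in> S" if "h1 \<in> S" "h2 \<in> S" for h1 h2
      using that by (simp add: S_def L.nat_pow_distrib)
    show "h1 \<oplus>\<^bsub>L\<^esub> h2 \<in> S" if "h1 \<in> S" "h2 \<in> S" for h1 h2
      using that L.freshmans_dream_power[OF p char, of h1 h2 k] by (simp add: S_def)
  qed (auto simp: S_def)
  then have "subfield S L"
  proof (rule L.subfieldI')
    fix x assume "x \<in> S - {\<zero>\<^bsub>L\<^esub>}"
    then have x: "x \<in> carrier L" "x \<noteq> \<zero>\<^bsub>L\<^esub>" "x [^]\<^bsub>L\<^esub> (p ^ k) = x" by (auto simp: S_def)
    then have i: "inv\<^bsub>L\<^esub> x \<in> carrier L" "x \<otimes>\<^bsub>L\<^esub> inv\<^bsub>L\<^esub> x = \<one>\<^bsub>L\<^esub>"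
      using L.field_Units by auto
    have "x \<otimes>\<^bsub>L\<^esub> (inv\<^bsub>L\<^esub> x) [^]\<^bsub>L\<^esub> (p ^ k) = \<one>\<^bsub>L\<^esub>"
      using L.nat_pow_distrib[OF x(1) i(1), of "p ^ k"] x(3) i(2) by simp
    then have "inv\<^bsub>L\<^esub> x = (inv\<^bsub>L\<^esub> x) [^]\<^bsub>L\<^esub> (p ^ k)"
      using x i by (metis L.comm_inv_char L.nat_pow_closed)
    then show "inv\<^bsub>L\<^esub> x \<in> S" using i by (simp add: S_def)
  qed
  then have "field (L\<lparr>carrier := S\<rparr>)" by (rule L.subfield_iff(2))
  moreover have "card S = p ^ k"
    unfolding S_def by (rule L.card_frobenius_fixed[OF p char k])
  ultimately show ?thesis by (intro exI[of _ "L\<lparr>carrier := S\<rparr>"]) simp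
qed

section \<open>Quadratic and quartic characters\<close>

lemma (in field) nonzero_inv:
  assumes "x \<in> carrier R" "x \<noteq> \<zero>"
  shows "inv x \<in> carrier R" "inv x \<noteq> \<zero>" "x \<otimes> inv x = \<one>" "inv x \<otimes> x = \<one>"
  using assms field_Units nonzero_imp_inverse_nonzero by auto

lemma i_power_mod_4: "\<i> ^ (n mod 4) = \<i> ^ n"
proof -
  have "\<i> ^ n = \<i> ^ (4 * (n div 4) + n mod 4)" by simp
  also have "\<dots> = (\<i> ^ 4) ^ (n div 4) * \<i> ^ (n mod 4)" by (simp only: power_add power_mult)
  finally show ?thesis by simp
qed

text \<open>The generator \<open>g\<close> has two roles: discrete logarithms to base
  \<open>g\<close> define the characters, and as a nonsquare \<open>g\<close> defines the
  anisotropic form \<open>x^2 - g y^2\<close>.\<close>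

locale paley_field = field F for F (structure) +
  fixes q :: nat and g
  assumes fin: "finite (carrier F)" and card_F: "card (carrier F) = q" and q_mod: "q mod 4 = 1"
    and g_carrier: "g \<in> carrier F" and g_nonzero: "g \<noteq> \<zero>"
    and g_gen: "carrier F - {\<zero>} = range (\<lambda>j::nat. g [^] j)"
begin

lemma g_pow_closed [simp]: "g [^] (j::nat) \<in> carrier F" and g_pow_nonzero [simp]: "g [^] j \<noteq> \<zero>"
  using g_gen by auto

lemma nonzero_cases:
  assumes "x \<in> carrier F" "x \<noteq> \<zero>"
  obtains j :: nat where "x = g [^] j"
  using assms g_gen by auto

lemma q_ge: "q \<ge> 5"
proof -
  have "card {\<zero>, \<one>} \<le> q" unfolding card_F[symmetric] by (rule card_mono[OF fin]) auto
  then have "q \<noteq> 1" by simp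
  then show ?thesis using q_mod by presburger
qed

lemma g_pow_eq_one_iff: "g [^] (n::nat) = \<one> \<longleftrightarrow> (q - 1) dvd n"
proof -
  interpret G: group "Multiplicative_Group.mult_of F" by (rule field_mult_group)
  have g: "g \<in> carrier (Multiplicative_Group.mult_of F)" using g_carrier g_nonzero by simp
  have "generate (Multiplicative_Group.mult_of F) {g} = {g [^] k | k. k \<in> (UNIV :: nat set)}"
    using G.generate_pow_on_finite_carrier[OF _ g] fin by (simp add: Multiplicative_Group.nat_pow_mult_of)
  then have "generate (Multiplicative_Group.mult_of F) {g} = carrier F - {\<zero>}" using g_gen by auto
  then have "G.ord g = q - 1"
    using G.generate_pow_card[OF g] fin card_F by simp
  then show ?thesis using G.pow_eq_id[OF g, of n] by (simp add: Multiplicative_Group.nat_pow_mult_of)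
qed

lemma g_pow_cong:
  assumes "g [^] (i::nat) = g [^] (j::nat)"
  shows "[i = j] (mod (q - 1))"
proof -
  have main: "[i = j] (mod (q - 1))" if "g [^] i = g [^] j" "i \<le> j" for i j :: nat
  proof -
    have "g [^] i \<otimes> g [^] (j - i) = g [^] i \<otimes> \<one>"
      using that(2) g_carrier that(1)[symmetric] by (simp add: nat_pow_mult)
    then have "g [^] (j - i) = \<one>" using m_lcancel[of "g [^] i" "g [^] (j - i)" \<one>] by simp
    then have "(q - 1) dvd (j - i)" by (simp add: g_pow_eq_one_iff)
    then show ?thesis using that(2) by (metis cong_sym cong_altdef_nat)
  qed
  show ?thesis using main[of i j] main[of j i] assms by (metis cong_sym nat_le_linear)
qed

lemma g_pow_cong_4:
  assumes "g [^] (i::nat) = g [^] (j::nat)"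
  shows "i mod 4 = j mod 4"
proof -
  have "4 dvd q - 1" using q_mod by presburger
  from cong_dvd_modulus_nat[OF g_pow_cong[OF assms] this] show ?thesis by (simp add: Cong.cong_def)
qed

text \<open>The quartic character with value \<open>i\<close> at \<open>g\<close>, extended by zero.
  Which logarithm is chosen is immaterial, because 4 divides \<open>q - 1\<close>.\<close>

definition chi :: "'a \<Rightarrow> complex" where
  "chi x = (if x = \<zero> then 0 else \<i> ^ (LEAST j::nat. g [^] j = x))"

lemma chi_zero [simp]: "chi \<zero> = 0"
  by (simp add: chi_def)

lemma chi_g_pow: "chi (g [^] j) = \<i> ^ j"
proof -
  have "g [^] (LEAST k::nat. g [^] k = g [^] j) = g [^] j" by (rule LeastI) simp
  from g_pow_cong_4[OF this] show ?thesis by (metis chi_def g_pow_nonzero i_power_mod_4)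
qed

lemma chi_mult:
  assumes "x \<in> carrier F" "y \<in> carrier F"
  shows "chi (x \<otimes> y) = chi x * chi y"
proof (cases "x = \<zero> \<or> y = \<zero>")
  case True
  then show ?thesis using assms by auto
next
  case False
  then obtain i j where "x = g [^] (i::nat)" "y = g [^] (j::nat)" using assms nonzero_cases by metis
  then show ?thesis using g_carrier by (simp add: nat_pow_mult chi_g_pow power_add)
qed

lemma chi_cases:
  assumes "x \<in> carrier F" "x \<noteq> \<zero>"
  shows "chi x \<in> {1, \<i>, -1, -\<i>}"
proof -
  obtain j where "x = g [^] (j::nat)" using assms nonzero_cases by metis
  then have "chi x = \<i> ^ (j mod 4)" by (simp add: chi_g_pow i_power_mod_4)
  moreover have "j mod 4 \<in> {0,1,2,3}" by auto
  ultimately show ?thesis by (auto simp: power3_eq_cube)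
qed

lemma norm_chi:
  assumes "x \<in> carrier F" "x \<noteq> \<zero>"
  shows "chi x * cnj (chi x) = 1" "cnj (chi x) = chi x ^ 3"
  using chi_cases[OF assms] by (auto simp: power3_eq_cube)

text \<open>The quadratic character, kept integer valued for use as a matrix entry; it is the square
  of \<open>chi\<close>.\<close>

definition rho :: "'a \<Rightarrow> int" where
  "rho x = (if x = \<zero> then 0 else if nonzero_square F x then 1 else -1)"

lemma rho_zero [simp]: "rho \<zero> = 0"
  by (simp add: rho_def)

lemma nonzero_square_g_pow: "nonzero_square F (g [^] (j::nat)) \<longleftrightarrow> even j"
proof
  assume "nonzero_square F (g [^] j)"
  then obtain y where y: "y \<in> carrier F" "g [^] j = y \<otimes> y" by (auto simp: nonzero_square_def)
  then have "y \<noteq> \<zero>" using g_pow_nonzero[of j] by auto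
  then obtain k where "y = g [^] (k::nat)" using y nonzero_cases by metis
  then have "g [^] j = g [^] (k + k)" using y g_carrier by (simp add: nat_pow_mult)
  from g_pow_cong_4[OF this] show "even j" by presburger
next
  assume "even j"
  then obtain k where "j = k + k" by (metis evenE mult_2)
  then have "g [^] j = g [^] k \<otimes> g [^] k" using g_carrier by (simp add: nat_pow_mult)
  then show "nonzero_square F (g [^] j)" unfolding nonzero_square_def by auto
qed

lemma rho_g_pow: "rho (g [^] (j::nat)) = (- 1) ^ j"
proof (cases "even j")
  case True
  then show ?thesis using nonzero_square_g_pow[of j] by (simp add: rho_def)
next
  case False
  then show ?thesis using nonzero_square_g_pow[of j] by (simp add: rho_def)
qed

lemma rho_chi:
  assumes "x \<in> carrier F"
  shows "of_int (rho x) = chi x ^ 2"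
proof (cases "x = \<zero>")
  case False
  obtain j where "x = g [^] (j::nat)" by (rule nonzero_cases[OF assms False])
  moreover have "(\<i> ^ j) ^ 2 = (\<i> ^ 2) ^ j" by (simp only: power_mult[symmetric] mult.commute)
  ultimately show ?thesis by (simp add: rho_g_pow chi_g_pow)
qed simp

lemma rho_mult:
  assumes "x \<in> carrier F" "y \<in> carrier F"
  shows "rho (x \<otimes> y) = rho x * rho y"
proof -
  have "(of_int (rho (x \<otimes> y)) :: complex) = of_int (rho x * rho y)"
    using assms by (simp add: rho_chi chi_mult power_mult_distrib)
  then show ?thesis by (simp only: of_int_eq_iff)
qed

lemma rho_square:
  assumes "x \<in> carrier F" "x \<noteq> \<zero>"
  shows "rho x * rho x = 1"
  using assms by (auto simp: rho_def)

text \<open>If \<open>-1 = g^j\<close> then \<open>q - 1\<close>, and with it 4, divides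
  \<open>2j\<close>, so \<open>j\<close> is even. This is what makes the conference matrix
  symmetric.\<close>

lemma rho_minus_one: "rho (\<ominus> \<one>) = 1"
proof -
  obtain j where j: "\<ominus> \<one> = g [^] (j::nat)" using nonzero_cases[of "\<ominus> \<one>"] by auto
  have "g [^] (j + j) = \<one>" using g_carrier by (simp add: nat_pow_mult[symmetric] j[symmetric] l_minus)
  then have "(q - 1) dvd (j + j)" by (simp add: g_pow_eq_one_iff)
  moreover have "4 dvd q - 1" using q_mod by presburger
  ultimately have "4 dvd j + j" by (rule dvd_trans[rotated])
  then have "even j" by presburger
  then show ?thesis unfolding j by (simp add: rho_g_pow)
qed

lemma rho_uminus:
  assumes "x \<in> carrier F"
  shows "rho (\<ominus> x) = rho x"
  using rho_mult[of "\<ominus> \<one>" x] assms by (simp add: rho_minus_one l_minus)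

lemma rho_minus_commute:
  assumes "x \<in> carrier F" "y \<in> carrier F"
  shows "rho (x \<ominus> y) = rho (y \<ominus> x)"
  using rho_uminus[of "y \<ominus> x"] assms by (simp add: a_minus_def minus_add a_comm)

text \<open>Substituting \<open>g x\<close> for \<open>x\<close> permutes the field and changes the
  sign of every term.\<close>

lemma sum_rho: "(\<Sum>x\<in>carrier F. rho x) = 0"
proof -
  have "(\<Sum>x\<in>carrier F. rho x) = (\<Sum>x\<in>carrier F. rho (g \<otimes> x))"
    by (rule sum.reindex_bij_witness[where i = "\<lambda>x. g \<otimes> x" and j = "\<lambda>x. inv g \<otimes> x"])
       (use g_carrier g_nonzero in \<open>auto simp: field_Units m_assoc[symmetric]\<close>)
  also have "\<dots> = - (\<Sum>x\<in>carrier F. rho x)"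
    using rho_g_pow[of 1] g_carrier by (simp add: rho_mult sum_negf)
  finally show ?thesis by simp
qed

lemma sum_rho_shift:
  assumes "a \<in> carrier F"
  shows "(\<Sum>x\<in>carrier F. rho (x \<ominus> a)) = 0"
proof -
  have "(\<Sum>x\<in>carrier F. rho (x \<ominus> a)) = (\<Sum>x\<in>carrier F. rho x)"
    by (rule sum.reindex_bij_witness[where i = "\<lambda>x. x \<oplus> a" and j = "\<lambda>x. x \<ominus> a"])
       (use assms in \<open>auto simp: a_minus_def a_assoc l_neg r_neg\<close>)
  then show ?thesis by (simp add: sum_rho)
qed

text \<open>For \<open>a \<noteq> b\<close> a shift reduces to the sum of
  \<open>rho y * rho (y - c)\<close> with \<open>c \<noteq> 0\<close>. For nonzero \<open>y\<close>
  this term is \<open>rho (1 - c / y)\<close>, and \<open>t = 1 - c / y\<close> runs through all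
  field elements except 1, so the sum is \<open>0 - rho 1\<close>.\<close>

lemma sum_rho_shift2:
  assumes a: "a \<in> carrier F" and b: "b \<in> carrier F"
  shows "(\<Sum>y\<in>carrier F. rho (y \<ominus> a) * rho (y \<ominus> b)) = (if a = b then int q - 1 else -1)"
proof (cases "a = b")
  case True
  have "(\<Sum>y\<in>carrier F. rho (y \<ominus> a) * rho (y \<ominus> a)) = (\<Sum>y\<in>carrier F. if y = a then 0 else 1)"
    using a by (intro sum.cong refl) (auto simp: rho_square r_right_minus_eq[THEN iffD2])
  also have "\<dots> = (\<Sum>y\<in>carrier F - {a}. 1)"
    by (rule sum.mono_neutral_cong_right) (use fin in auto)
  also have "\<dots> = int q - 1" using a fin card_F q_ge by (simp add: of_nat_diff)
  finally show ?thesis using True by simp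
next
  case False
  define c where "c = b \<ominus> a"
  have c: "c \<in> carrier F" "c \<noteq> \<zero>" using a b False by (auto simp: c_def)
  have "(\<Sum>y\<in>carrier F. rho (y \<ominus> a) * rho (y \<ominus> b)) = (\<Sum>y\<in>carrier F. rho y * rho (y \<ominus> c))"
    by (rule sum.reindex_bij_witness[where i = "\<lambda>x. x \<oplus> a" and j = "\<lambda>x. x \<ominus> a"])
       (use a b in \<open>auto simp: c_def a_minus_def a_assoc l_neg r_neg minus_add a_ac r_neg1 r_neg2\<close>)
  also have "\<dots> = (\<Sum>y\<in>carrier F - {\<zero>}. rho y * rho (y \<ominus> c))"
    by (rule sum.mono_neutral_right) (use fin in auto)
  also have "\<dots> = (\<Sum>t\<in>carrier F - {\<one>}. rho t)"
  proof (rule sum.reindex_bij_witness[where i = "\<lambda>t. c \<otimes> inv (\<one> \<ominus> t)" and j = "\<lambda>y. \<one> \<ominus> c \<otimes> inv y"])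
    fix y assume "y \<in> carrier F - {\<zero>}"
    then have y: "y \<in> carrier F" "y \<noteq> \<zero>" by auto
    note iy = nonzero_inv[OF y]
    have ci: "c \<otimes> inv y \<in> carrier F" "c \<otimes> inv y \<noteq> \<zero>" using c iy integral by auto
    have e: "\<one> \<ominus> (\<one> \<ominus> c \<otimes> inv y) = c \<otimes> inv y"
      using ci by (simp add: a_minus_def minus_add r_neg2)
    show "c \<otimes> inv (\<one> \<ominus> (\<one> \<ominus> c \<otimes> inv y)) = y"
      unfolding e using c y iy ci
      by (metis (no_types, lifting) field_Units DiffI singletonD Units_inv_closed Units_r_inv m_assoc m_comm r_one)
    show "\<one> \<ominus> c \<otimes> inv y \<in> carrier F - {\<one>}"
      using ci e by (metis DiffI minus_closed one_closed r_right_minus_eq singletonD)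
    have "y \<ominus> c = y \<otimes> (\<one> \<ominus> c \<otimes> inv y)"
      using c y iy ci by (simp add: a_minus_def r_distr r_minus m_lcomm)
    then have "rho (y \<ominus> c) = rho y * rho (\<one> \<ominus> c \<otimes> inv y)"
      using y ci by (simp add: rho_mult)
    then show "rho (\<one> \<ominus> c \<otimes> inv y) = rho y * rho (y \<ominus> c)"
      using rho_square[OF y] by (simp flip: mult.assoc)
  next
    fix t assume "t \<in> carrier F - {\<one>}"
    then have t: "t \<in> carrier F" "\<one> \<ominus> t \<noteq> \<zero>" "\<one> \<ominus> t \<in> carrier F" by auto
    note it = nonzero_inv[OF t(3,2)] and ic = nonzero_inv[OF c]
    have y: "c \<otimes> inv (\<one> \<ominus> t) \<in> carrier F" "c \<otimes> inv (\<one> \<ominus> t) \<noteq> \<zero>"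
      using integral[OF _ c(1) it(1)] c it by auto
    then show "c \<otimes> inv (\<one> \<ominus> t) \<in> carrier F - {\<zero>}" by blast
    have "c \<otimes> inv (c \<otimes> inv (\<one> \<ominus> t)) = \<one> \<ominus> t"
    proof -
      have "(c \<otimes> inv (\<one> \<ominus> t)) \<otimes> (inv c \<otimes> (\<one> \<ominus> t)) = (c \<otimes> inv c) \<otimes> (inv (\<one> \<ominus> t) \<otimes> (\<one> \<ominus> t))"
        using c(1) it(1) t(3) ic(1) by (simp add: m_ac)
      also have "\<dots> = \<one>" by (simp only: it ic r_one one_closed)
      finally have "inv (c \<otimes> inv (\<one> \<ominus> t)) = inv c \<otimes> (\<one> \<ominus> t)"
        by (intro comm_inv_char y m_closed ic(1) t(3))
      then have "c \<otimes> inv (c \<otimes> inv (\<one> \<ominus> t)) = (c \<otimes> inv c) \<otimes> (\<one> \<ominus> t)"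
        by (simp only: m_assoc[OF c(1) ic(1) t(3)])
      then show ?thesis by (simp only: ic l_one t(3))
    qed
    moreover have "\<one> \<ominus> (\<one> \<ominus> t) = t" using t(1) by algebra
    ultimately show "\<one> \<ominus> c \<otimes> inv (c \<otimes> inv (\<one> \<ominus> t)) = t" by simp
  qed
  also have "\<dots> = (\<Sum>t\<in>carrier F. rho t) - rho \<one>"
    using fin by (simp add: sum_diff1)
  also have "rho \<one> = 1" using rho_g_pow[of 0] by simp
  finally show ?thesis using False by (simp add: sum_rho)
qed

end

section \<open>The quartic eigenvector of the conference matrix\<close>

context paley_field
begin

section \<open>The projective line and its conference matrix\<close>

text \<open>The projective line over the field, with \<open>None\<close> as the point at
  infinity.\<close>

definition points :: "'a option set" where
  "points = insert None (Some ` carrier F)"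

lemma finite_points [simp]: "finite points"
  using fin by (simp add: points_def)

lemma sum_points:
  fixes f :: "'a option \<Rightarrow> 'c :: comm_monoid_add"
  shows "(\<Sum>x\<in>points. f x) = f None + (\<Sum>x\<in>carrier F. f (Some x))"
proof -
  have "(\<Sum>x\<in>Some ` carrier F. f x) = (\<Sum>x\<in>carrier F. f (Some x))"
    by (subst sum.reindex) (auto simp: inj_on_def)
  then show ?thesis unfolding points_def using fin by (subst sum.insert) auto
qed

lemma points_cases:
  assumes "x \<in> points"
  obtains "x = None" | a where "x = Some a" "a \<in> carrier F"
  using assms by (auto simp: points_def)

fun conference :: "'a option \<Rightarrow> 'a option \<Rightarrow> int" where
  "conference None None = 0"
| "conference None (Some b) = 1"
| "conference (Some a) None = 1"
| "conference (Some a) (Some b) = rho (b \<ominus> a)"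

lemma conference_sym:
  assumes "x \<in> points" "y \<in> points"
  shows "conference x y = conference y x"
  using assms by (elim points_cases) (auto simp: rho_minus_commute)

lemma conference_diag:
  assumes "x \<in> points"
  shows "conference x x = 0"
  using assms by (elim points_cases) (auto simp: r_right_minus_eq[THEN iffD2])

lemma conference_abs:
  assumes "x \<in> points" "y \<in> points" "x \<noteq> y"
  shows "conference x y \<in> {1, -1}"
  using assms by (elim points_cases) (auto simp: rho_def)

text \<open>The conference matrix identity \<open>C C^T = q I\<close>. Two finite rows share the
  entry \<open>1 * 1\<close> at infinity, which compensates the value \<open>-1\<close> of the
  shifted character sum if they differ and completes \<open>q - 1\<close> to \<open>q\<close> if
  they coincide.\<close>

lemma conference_orth:
  assumes "x \<in> points" "x' \<in> points"
  shows "(\<Sum>y\<in>points. conference x y * conference x' y) = (if x = x' then int q else 0)"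
  using assms
proof (elim points_cases)
  fix a b assume "x = Some a" "a \<in> carrier F" "x' = Some b" "b \<in> carrier F"
  then show ?thesis by (simp add: sum_points sum_rho_shift2)
qed (auto simp: sum_points sum_rho_shift card_F)

section \<open>The quartic vector and its image under the conference matrix\<close>

text \<open>The quartic character of the form \<open>x^2 - g y^2\<close> at the representatives
  \<open>(1, 0)\<close> of infinity and \<open>(x, 1)\<close> of a field element.\<close>

fun wt :: "'a option \<Rightarrow> complex" where
  "wt None = 1"
| "wt (Some x) = chi (x \<otimes> x \<ominus> g)"

text \<open>The number \<open>J\<close> of the outline: the entry of \<open>C w\<close> at
  infinity.\<close>

definition quartic_sum :: complex where
  "quartic_sum = (\<Sum>z\<in>carrier F. chi (z \<otimes> z \<ominus> g))"

text \<open>Anisotropy of the form: \<open>g\<close> is an odd power of the generator and hence no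
  square.\<close>

lemma square_minus_g_nonzero:
  assumes "x \<in> carrier F"
  shows "x \<otimes> x \<ominus> g \<noteq> \<zero>"
proof
  assume "x \<otimes> x \<ominus> g = \<zero>"
  then have "x \<otimes> x = g" using assms g_carrier by simp
  then have "nonzero_square F g" using assms g_nonzero by (auto simp: nonzero_square_def)
  moreover have "g = g [^] (1::nat)" using g_carrier by simp
  ultimately show False using nonzero_square_g_pow[of 1] by simp
qed

lemma wt_cases:
  assumes "x \<in> points"
  shows "wt x \<in> {1, \<i>, -1, -\<i>}"
  using assms
proof (cases rule: points_cases)
  case (2 a)
  then show ?thesis
    using chi_cases[OF _ square_minus_g_nonzero[of a]] g_carrier by simp
qed simp

lemma conference_wt_None: "(\<Sum>y\<in>points. of_int (conference None y) * wt y) = quartic_sum"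
  by (simp add: sum_points quartic_sum_def)

text \<open>The substitution \<open>y = (x z + g) / (z + x)\<close> is multiplication by \<open>x + \<surd>g\<close> on the projective
  line; it multiplies the norm form \<open>y\<^sup>2 - g\<close> by \<open>(x\<^sup>2 - g) / (z + x)\<^sup>2\<close>.\<close>

lemma conference_wt_Some:
  assumes x: "x \<in> carrier F"
  shows "(\<Sum>y\<in>points. of_int (conference (Some x) y) * wt y) = quartic_sum * cnj (wt (Some x))"
proof -
  let ?Q = "\<lambda>z. z \<otimes> z \<ominus> g"
  have Qc: "?Q z \<in> carrier F" if "z \<in> carrier F" for z using that g_carrier by simp
  let ?m = "\<lambda>z. (x \<otimes> z \<oplus> g) \<otimes> inv (z \<oplus> x)"
  have xQ: "?Q x \<in> carrier F" "?Q x \<noteq> \<zero>" using Qc[OF x] square_minus_g_nonzero[OF x] by auto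
  have "(\<Sum>y\<in>carrier F. of_int (rho (y \<ominus> x)) * chi (?Q y))
      = (\<Sum>y\<in>carrier F - {x}. of_int (rho (y \<ominus> x)) * chi (?Q y))"
    by (rule sum.mono_neutral_right) (use fin x in \<open>auto simp: r_right_minus_eq[THEN iffD2]\<close>)
  also have "\<dots> = (\<Sum>z\<in>carrier F - {\<ominus> x}. cnj (chi (?Q x)) * chi (?Q z))"
  \<comment> \<open>Solving \<open>y (z + x) = x z + g\<close> for \<open>z\<close> gives the
    inverse map \<open>z = (g - x y) / (y - x)\<close>.\<close>
  proof (rule sum.reindex_bij_witness[where i = ?m and j = "\<lambda>y. (g \<ominus> x \<otimes> y) \<otimes> inv (y \<ominus> x)"])
    fix z assume "z \<in> carrier F - {\<ominus> x}"
    then have z: "z \<in> carrier F" "z \<noteq> \<ominus> x" by auto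
    define s where "s = z \<oplus> x"
    have s: "s \<in> carrier F" "s \<noteq> \<zero>"
      using z x unfolding s_def by (auto simp: sum_zero_eq_neg)
    note sinv = nonzero_inv[OF s]
    define y where "y = (x \<otimes> z \<oplus> g) \<otimes> inv s"
    have yc: "y \<in> carrier F" using x z g_carrier sinv by (simp add: y_def)
    have ys: "y \<otimes> s = x \<otimes> z \<oplus> g"
      using x z g_carrier s sinv unfolding y_def by (simp add: m_assoc)
    have yx: "(y \<ominus> x) \<otimes> s = \<ominus> ?Q x"
    proof -
      have "(y \<ominus> x) \<otimes> s = y \<otimes> s \<ominus> x \<otimes> s" using yc x s by algebra
      also have "\<dots> = \<ominus> ?Q x" unfolding ys unfolding s_def using x z g_carrier by algebra
      finally show ?thesis .
    qed
    have yxn: "y \<ominus> x \<noteq> \<zero>"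
    proof
      assume "y \<ominus> x = \<zero>"
      with yx s have "\<ominus> ?Q x = \<zero>" by simp
      with xQ show False by simp
    qed
    show "?m z \<in> carrier F - {x}"
      using yc yxn x unfolding y_def s_def by auto
    show "(g \<ominus> x \<otimes> ?m z) \<otimes> inv (?m z \<ominus> x) = z"
    proof -
      have yxc: "y \<ominus> x \<in> carrier F" using yc x by simp
      have "(g \<ominus> x \<otimes> y) \<otimes> s = g \<otimes> s \<ominus> x \<otimes> (y \<otimes> s)" using yc x s g_carrier by algebra
      also have "\<dots> = z \<otimes> (\<ominus> ?Q x)" unfolding ys unfolding s_def using x z g_carrier by algebra
      also have "\<dots> = (z \<otimes> (y \<ominus> x)) \<otimes> s" using yx z yxc s by (simp add: m_assoc)
      finally have "(g \<ominus> x \<otimes> y) \<otimes> s = (z \<otimes> (y \<ominus> x)) \<otimes> s" .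
      then have "g \<ominus> x \<otimes> y = z \<otimes> (y \<ominus> x)"
        using m_rcancel[OF s(2) s(1)] yc x z g_carrier by simp
      then have "(g \<ominus> x \<otimes> y) \<otimes> inv (y \<ominus> x) = z \<otimes> ((y \<ominus> x) \<otimes> inv (y \<ominus> x))"
        using z yxc nonzero_inv[OF yxc yxn] by (simp add: m_assoc)
      then show ?thesis using nonzero_inv[OF yxc yxn] z unfolding y_def s_def by simp
    qed
  next
    fix y assume "y \<in> carrier F - {x}"
    then have y: "y \<in> carrier F" "y \<ominus> x \<in> carrier F" "y \<ominus> x \<noteq> \<zero>" using x by auto
    define t where "t = y \<ominus> x"
    have t: "t \<in> carrier F" "t \<noteq> \<zero>" using y by (auto simp: t_def)
    note it = nonzero_inv[OF t]
    define z where "z = (g \<ominus> x \<otimes> y) \<otimes> inv t"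
    have zc: "z \<in> carrier F" using x y g_carrier it by (simp add: z_def)
    have zt: "z \<otimes> t = g \<ominus> x \<otimes> y"
      using x y g_carrier t it unfolding z_def by (simp add: m_assoc)
    define s where "s = z \<oplus> x"
    have sc: "s \<in> carrier F" using zc x by (simp add: s_def)
    have st: "s \<otimes> t = \<ominus> ?Q x"
    proof -
      have "s \<otimes> t = z \<otimes> t \<oplus> x \<otimes> t" using zc x t unfolding s_def by algebra
      also have "\<dots> = \<ominus> ?Q x" unfolding zt unfolding t_def using x y(1) g_carrier by algebra
      finally show ?thesis .
    qed
    have s: "s \<noteq> \<zero>"
    proof
      assume "s = \<zero>"
      with st t have "\<ominus> ?Q x = \<zero>" by simp
      with xQ show False by simp
    qed
    note sinv = nonzero_inv[OF sc s]
    have zn: "z \<noteq> \<ominus> x" using s x unfolding s_def by (auto simp: l_neg)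
    then show "(g \<ominus> x \<otimes> y) \<otimes> inv (y \<ominus> x) \<in> carrier F - {\<ominus> x}"
      using zc unfolding z_def t_def by auto
    have ys: "y \<otimes> s = x \<otimes> z \<oplus> g"
    proof -
      have "y \<otimes> s = z \<otimes> t \<oplus> x \<otimes> z \<oplus> x \<otimes> y" using y(1) zc x unfolding s_def t_def by algebra
      also have "\<dots> = x \<otimes> z \<oplus> g" unfolding zt using x y(1) zc g_carrier by algebra
      finally show ?thesis .
    qed
    have "?m z = y"
    proof -
      have "?m z = y \<otimes> (s \<otimes> inv s)" unfolding s_def[symmetric] ys[symmetric]
        using y(1) sc sinv by (simp add: m_assoc)
      then show ?thesis using sinv y(1) by simp
    qed
    then show "?m ((g \<ominus> x \<otimes> y) \<otimes> inv (y \<ominus> x)) = y" unfolding z_def t_def .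
    \<comment> \<open>Multiplicativity of the norm form. Since \<open>chi (s^2) = rho s\<close>, it
      determines \<open>chi (y^2 - g)\<close> up to the sign \<open>rho s\<close>.\<close>
    have Qy: "?Q y \<otimes> (s \<otimes> s) = ?Q x \<otimes> ?Q z"
    proof -
      have "?Q y \<otimes> (s \<otimes> s) = (y \<otimes> s) \<otimes> (y \<otimes> s) \<ominus> g \<otimes> (s \<otimes> s)"
        using y(1) sc g_carrier by algebra
      also have "\<dots> = ?Q x \<otimes> ?Q z" unfolding ys unfolding s_def using x zc g_carrier by algebra
      finally show ?thesis .
    qed
    have cs: "chi (s \<otimes> s) = of_int (rho s)" using sc by (simp add: chi_mult rho_chi power2_eq_square)
    have r2: "of_int (rho s) * of_int (rho s) = (1::complex)"
      using rho_square[OF sc s] by (metis of_int_1 of_int_mult)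
    have A: "chi (?Q y) = of_int (rho s) * (chi (?Q x) * chi (?Q z))"
    proof -
      have "chi (?Q y) * of_int (rho s) = chi (?Q x) * chi (?Q z)"
        using arg_cong[OF Qy, of chi] Qc y(1) sc x zc cs by (simp add: chi_mult)
      then have "chi (?Q x) * chi (?Q z) * of_int (rho s) = chi (?Q y) * (of_int (rho s) * of_int (rho s))"
        by (simp add: mult.assoc[symmetric])
      then show ?thesis using r2 by (simp add: mult.commute)
    qed
    \<comment> \<open>The relation \<open>st\<close> between \<open>s\<close> and
      \<open>t = y - x\<close> yields the same sign \<open>rho s\<close>, which therefore cancels in
      the product. What remains is the cube of \<open>chi (x^2 - g)\<close>, its conjugate.\<close>
    have B: "rho (y \<ominus> x) = rho s * rho (?Q x)"
    proof -
      have "rho s * rho t = rho (?Q x)"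
        using arg_cong[OF st, of rho] sc t xQ by (simp add: rho_mult rho_uminus)
      then have "rho s * rho (?Q x) = (rho s * rho s) * rho t" by (metis mult.assoc)
      then show ?thesis using rho_square[OF sc s] by (simp add: t_def)
    qed
    have "of_int (rho (y \<ominus> x)) * chi (?Q y)
        = (of_int (rho s) * of_int (rho s)) * (chi (?Q x) ^ 2 * chi (?Q x)) * chi (?Q z)"
      unfolding A B of_int_mult rho_chi[OF xQ(1)] by (simp add: mult_ac)
    also have "\<dots> = chi (?Q x) ^ 3 * chi (?Q z)" unfolding r2
      by (simp add: power2_eq_square power3_eq_cube)
    also have "\<dots> = cnj (chi (?Q x)) * chi (?Q z)" using norm_chi(2)[OF xQ] by simp
    finally show "cnj (chi (?Q x)) * chi (?Q ((g \<ominus> x \<otimes> y) \<otimes> inv (y \<ominus> x)))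
        = of_int (rho (y \<ominus> x)) * chi (?Q y)"
      unfolding z_def t_def by simp
  qed
  \<comment> \<open>The omitted point \<open>z = - x\<close> costs exactly 1, which is restored by
    the entry of the row at infinity.\<close>
  also have "\<dots> = cnj (chi (?Q x)) * quartic_sum - cnj (chi (?Q x)) * chi (?Q (\<ominus> x))"
    using fin x by (simp add: sum_diff1 quartic_sum_def sum_distrib_left)
  also have "?Q (\<ominus> x) = ?Q x" using x by (simp add: l_minus r_minus)
  also have "cnj (chi (?Q x)) * chi (?Q x) = 1" using norm_chi(1)[OF xQ] by (simp add: mult.commute)
  finally show ?thesis by (simp add: sum_points mult.commute)
qed

lemma conference_wt:
  assumes "x \<in> points"
  shows "(\<Sum>y\<in>points. of_int (conference x y) * wt y) = quartic_sum * cnj (wt x)"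
  using assms by (cases rule: points_cases) (auto simp only: conference_wt_None conference_wt_Some, simp)

text \<open>Apply \<open>C\<close> twice and look at infinity: \<open>J * cnj J\<close> is the sum
  of \<open>C(None, x) * J * cnj (w x)\<close>, that is the entry of \<open>C (C w) = q w\<close> at
  infinity, where \<open>w\<close> is 1.\<close>

lemma quartic_sum_norm: "quartic_sum * cnj quartic_sum = of_nat q"
proof -
  have "quartic_sum * cnj quartic_sum = (\<Sum>x\<in>points. of_int (conference None x) * (quartic_sum * cnj (wt x)))"
  proof -
    have "cnj quartic_sum = (\<Sum>x\<in>points. of_int (conference None x) * cnj (wt x))"
      unfolding conference_wt_None[symmetric] by simp
    then show ?thesis by (simp add: sum_distrib_left mult_ac)
  qed
  also have "\<dots> = (\<Sum>x\<in>points. of_int (conference None x) * (\<Sum>y\<in>points. of_int (conference x y) * wt y))"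
    by (intro sum.cong refl) (simp add: conference_wt)
  also have "\<dots> = (\<Sum>y\<in>points. wt y * (\<Sum>x\<in>points. of_int (conference None x) * of_int (conference x y)))"
    unfolding sum_distrib_left by (subst sum.swap) (simp add: mult_ac)
  also have "\<dots> = (\<Sum>y\<in>points. wt y * of_int (if None = y then int q else 0))"
  proof (intro sum.cong refl arg_cong2[where f = "(*)"])
    fix y assume y: "y \<in> points"
    have "(\<Sum>x\<in>points. of_int (conference None x) * of_int (conference x y))
        = (of_int (\<Sum>x\<in>points. conference None x * conference y x) :: complex)"
      unfolding of_int_sum of_int_mult
      by (intro sum.cong refl) (simp add: conference_sym[OF y])
    also have "(\<Sum>x\<in>points. conference None x * conference y x) = (if None = y then int q else 0)"
      by (rule conference_orth[OF _ y]) (simp add: points_def)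
    finally show "(\<Sum>x\<in>points. of_int (conference None x) * of_int (conference x y))
        = (of_int (if None = y then int q else 0) :: complex)" .
  qed
  also have "\<dots> = of_nat q" by (simp add: sum_points)
  finally show ?thesis .
qed

end

section \<open>Reduction of the quartic sum modulo the characteristic\<close>

lemma (in abelian_monoid) finsum_swap:
  assumes "finite A" "finite B" "\<And>a b. a \<in> A \<Longrightarrow> b \<in> B \<Longrightarrow> f a b \<in> carrier G"
  shows "(\<Oplus>a\<in>A. \<Oplus>b\<in>B. f a b) = (\<Oplus>b\<in>B. \<Oplus>a\<in>A. f a b)"
  using assms(1,3)
proof (induction A)
  case empty
  then show ?case by simp
next
  case (insert x A)
  have "(\<Oplus>a\<in>insert x A. \<Oplus>b\<in>B. f a b) = (\<Oplus>b\<in>B. f x b) \<oplus> (\<Oplus>b\<in>B. \<Oplus>a\<in>A. f a b)"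
    using insert by (subst finsum_insert) (auto intro!: finsum_closed)
  also have "\<dots> = (\<Oplus>b\<in>B. f x b \<oplus> (\<Oplus>a\<in>A. f a b))"
    using insert by (intro finsum_addf[symmetric]) (auto intro!: finsum_closed)
  also have "\<dots> = (\<Oplus>b\<in>B. \<Oplus>a\<in>insert x A. f a b)"
    using insert by (intro finsum_cong') (auto intro!: finsum_closed)
  finally show ?case .
qed

lemma (in abelian_group) add_pow_sum:
  fixes a :: "'c \<Rightarrow> int"
  assumes "finite A" "x \<in> carrier G"
  shows "add_pow G (\<Sum>z\<in>A. a z) x = (\<Oplus>z\<in>A. add_pow G (a z) x)"
  using assms
proof (induction A)
  case empty
  then show ?case by (simp add: add_pow_int_ge)
next
  case (insert y A)
  then show ?case by (simp add: add.int_pow_mult)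
qed

context paley_field
begin

section \<open>Power sums over the finite field\<close>

text \<open>If \<open>q - 1\<close> does not divide \<open>n\<close>, multiplying the variable by
  \<open>g\<close> scales the sum by \<open>g^n \<noteq> 1\<close>, so it vanishes. If it divides a
  positive \<open>n\<close>, each nonzero element contributes 1, giving \<open>q - 1 = -1\<close>.
  For \<open>n = 0\<close> the convention \<open>0^0 = 1\<close> gives \<open>q = 0\<close> in the
  field.\<close>

lemma finsum_power:
  "(\<Oplus>z\<in>carrier F. z [^] (n::nat)) = (if n > 0 \<and> (q - 1) dvd n then \<ominus> \<one> else \<zero>)"
proof -
  let ?S = "\<Oplus>z\<in>carrier F. z [^] n"
  have S: "?S \<in> carrier F" by (rule finsum_closed) auto
  have ord: "add_pow F q \<one> = \<zero>"
    using add.pow_order_eq_1[of \<one>] by (simp add: order_def card_F)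
  consider "n = 0" | "n > 0" "(q - 1) dvd n" | "\<not> (q - 1) dvd n" by (cases "n = 0") auto
  then show ?thesis
  proof cases
    case 1
    then show ?thesis using ord add.finprod_const[of \<one> "carrier F"] by (simp add: card_F)
  next
    case 2
    have one: "z [^] n = \<one>" if z: "z \<in> carrier F" "z \<noteq> \<zero>" for z
    proof -
      obtain j where "z = g [^] (j::nat)" by (rule nonzero_cases[OF z])
      then have "z [^] n = g [^] (j * n)" using g_carrier by (simp add: nat_pow_pow)
      then show ?thesis using 2 by (simp add: g_pow_eq_one_iff)
    qed
    have "?S = (\<Oplus>z\<in>insert \<zero> (carrier F - {\<zero>}). z [^] n)" by (simp add: insert_absorb)
    also have "\<dots> = \<zero> [^] n \<oplus> (\<Oplus>z\<in>carrier F - {\<zero>}. z [^] n)"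
      using fin by (subst finsum_insert) auto
    also have "(\<Oplus>z\<in>carrier F - {\<zero>}. z [^] n) = (\<Oplus>z\<in>carrier F - {\<zero>}. \<one>)"
      by (rule finsum_cong') (auto simp: one)
    also have "\<dots> = add_pow F (q - 1) \<one>"
      using add.finprod_const[of \<one> "carrier F - {\<zero>}"] fin card_F by simp
    also have "\<zero> [^] n = \<zero>" using 2 by (simp add: nat_pow_zero)
    finally have "?S = add_pow F (q - 1) \<one>" by simp
    moreover have "add_pow F (q - 1) \<one> \<oplus> \<one> = \<zero>"
    proof -
      have "q = Suc (q - 1)" using q_ge by simp
      then have "add_pow F (Suc (q - 1)) \<one> = \<zero>" using ord by simp
      then show ?thesis by simp
    qed
    then have "add_pow F (q - 1) \<one> = \<ominus> \<one>" by (simp add: sum_zero_eq_neg)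
    ultimately show ?thesis using 2 by simp
  next
    case 3
    have inj: "inj_on (\<lambda>z. g \<otimes> z) (carrier F)"
      using g_carrier g_nonzero by (auto simp: inj_on_def m_lcancel)
    then have im: "(\<lambda>z. g \<otimes> z) ` carrier F = carrier F"
      using g_carrier by (intro endo_inj_surj fin) auto
    have "?S = (\<Oplus>z\<in>(\<lambda>z. g \<otimes> z) ` carrier F. z [^] n)" by (simp only: im)
    also have "\<dots> = (\<Oplus>z\<in>carrier F. (g \<otimes> z) [^] n)"
      using finsum_reindex[OF _ inj, of "\<lambda>z. z [^] n"] im by auto
    also have "\<dots> = (\<Oplus>z\<in>carrier F. g [^] n \<otimes> z [^] n)"
      using g_carrier by (intro finsum_cong') (auto simp: nat_pow_distrib)
    also have "\<dots> = g [^] n \<otimes> ?S"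
      by (rule finsum_rdistr[symmetric]) (use fin in auto)
    finally have "(g [^] n \<ominus> \<one>) \<otimes> ?S = \<zero>"
      using S by (simp add: a_minus_def l_distr l_minus r_neg)
    moreover have "g [^] n \<ominus> \<one> \<noteq> \<zero>" using 3 by (simp add: g_pow_eq_one_iff)
    ultimately have "?S = \<zero>" using integral[of "g [^] n \<ominus> \<one>" ?S] S by auto
    then show ?thesis using 3 by simp
  qed
qed

text \<open>After binomial expansion and exchange of sums, the inner sums are power sums of exponent
  \<open>2k \<le> 6N\<close>. Only the exponent \<open>4N = q - 1\<close> survives, leaving the
  single term \<open>k = 2N\<close>.\<close>

lemma finsum_quadratic_power:
  assumes N: "q = 4 * N + 1"
  shows "(\<Oplus>z\<in>carrier F. (z \<otimes> z \<ominus> g) [^] (3 * N))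
    = \<ominus> add_pow F (3 * N choose (2 * N)) ((\<ominus> g) [^] N)"
proof -
  have N0: "N > 0" using N q_ge by simp
  let ?c = "\<lambda>k. add_pow F (3 * N choose k) ((\<ominus> g) [^] (3 * N - k))"
  have c: "?c k \<in> carrier F" for k using g_carrier by simp
  have "(z \<otimes> z \<ominus> g) [^] (3 * N) = (\<Oplus>k\<in>{..3 * N}. ?c k \<otimes> z [^] (2 * k))" if z: "z \<in> carrier F" for z
  proof -
    have "z \<otimes> z = z [^] (2::nat)" using z by (simp add: numeral_2_eq_2)
    then have zk: "(z \<otimes> z) [^] k = z [^] (2 * k)" for k :: nat using z by (simp add: nat_pow_pow)
    have "(z \<otimes> z \<ominus> g) [^] (3 * N)
        = (\<Oplus>k\<in>{..3 * N}. add_pow F (3 * N choose k) ((z \<otimes> z) [^] k \<otimes> (\<ominus> g) [^] (3 * N - k)))"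
      unfolding a_minus_def using z g_carrier by (intro binomial_expansion) auto
    also have "\<dots> = (\<Oplus>k\<in>{..3 * N}. ?c k \<otimes> z [^] (2 * k))"
    proof (rule finsum_cong')
      fix k
      show "add_pow F (3 * N choose k) ((z \<otimes> z) [^] k \<otimes> (\<ominus> g) [^] (3 * N - k)) = ?c k \<otimes> z [^] (2 * k)"
        unfolding zk using z g_carrier by (subst add_pow_ldistr) (auto simp: m_comm)
    qed (use z g_carrier in auto)
    finally show ?thesis .
  qed
  then have "(\<Oplus>z\<in>carrier F. (z \<otimes> z \<ominus> g) [^] (3 * N))
      = (\<Oplus>z\<in>carrier F. \<Oplus>k\<in>{..3 * N}. ?c k \<otimes> z [^] (2 * k))"
    using c by (intro finsum_cong') (auto intro!: finsum_closed)
  also have "\<dots> = (\<Oplus>k\<in>{..3 * N}. \<Oplus>z\<in>carrier F. ?c k \<otimes> z [^] (2 * k))"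
    by (rule finsum_swap) (use fin c in auto)
  also have "\<dots> = (\<Oplus>k\<in>{..3 * N}. if 2 * N = k then \<ominus> ?c k else \<zero>)"
  proof (rule finsum_cong')
    fix k assume k: "k \<in> {..3 * N}"
    have "(\<Oplus>z\<in>carrier F. ?c k \<otimes> z [^] (2 * k)) = ?c k \<otimes> (\<Oplus>z\<in>carrier F. z [^] (2 * k))"
      by (rule finsum_rdistr[symmetric]) (use fin c in auto)
    also have "\<dots> = ?c k \<otimes> (if 2 * k > 0 \<and> (q - 1) dvd 2 * k then \<ominus> \<one> else \<zero>)"
      by (simp only: finsum_power)
    also have "(2 * k > 0 \<and> (q - 1) dvd 2 * k) \<longleftrightarrow> 2 * N = k"
    proof
      assume "2 * k > 0 \<and> (q - 1) dvd 2 * k"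
      then obtain r where r: "2 * k = (4 * N) * r" "r > 0" using N by (auto elim!: dvdE)
      have "r < 2"
      proof (rule ccontr)
        assume "\<not> r < 2"
        then have "(4 * N) * 2 \<le> (4 * N) * r" by (intro mult_le_mono) auto
        with r k N0 show False by simp
      qed
      with r have "r = 1" by simp
      with r show "2 * N = k" by simp
    next
      assume "2 * N = k"
      then show "2 * k > 0 \<and> (q - 1) dvd 2 * k" using N N0 by auto
    qed
    finally show "(\<Oplus>z\<in>carrier F. ?c k \<otimes> z [^] (2 * k)) = (if 2 * N = k then \<ominus> ?c k else \<zero>)"
      using c[of k] by (auto simp: r_minus)
  qed (use c in auto)
  also have "\<dots> = \<ominus> ?c (2 * N)"
    using add.finprod_singleton[of "2 * N" "{..3 * N}" "\<lambda>k. \<ominus> ?c k"] c by simp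
  finally show ?thesis by simp
qed

text \<open>Under the reduction sending \<open>i\<close> to \<open>- g\<^sup>N\<close>, where \<open>q = 4 N + 1\<close>, the value \<open>\<chi>(y)\<close> becomes
  \<open>y\<^sup>3\<^sup>N\<close>, and the resulting power sum is a nonzero multiple of a binomial coefficient prime to
  \<open>p\<close>.\<close>

lemma quartic_sum_not_divisible:
  assumes p: "prime p" "p mod 4 = 1" "q = p ^ k"
    and AB: "(\<Sum>z\<in>carrier F. chi (z \<otimes> z \<ominus> g)) = of_int A + \<i> * of_int B"
    and nz: "\<And>z. z \<in> carrier F \<Longrightarrow> z \<otimes> z \<ominus> g \<noteq> \<zero>"
  shows "\<not> (int p dvd A \<and> int p dvd B)"
proof
  assume dv: "int p dvd A \<and> int p dvd B"
  obtain N where N: "q = 4 * N + 1" using q_mod by (metis mult_div_mod_eq)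
  \<comment> \<open>As \<open>g\<close> has order \<open>4N\<close>, the element \<open>r\<close> is
    a square root of -1 in the field.\<close>
  define r where "r = g [^] N"
  have r: "r \<in> carrier F" by (simp add: r_def)
  have rr: "r \<otimes> r = \<ominus> \<one>"
  proof -
    have rr1: "r \<otimes> r = g [^] (2 * N)" using g_carrier by (simp add: r_def nat_pow_mult mult_2)
    have "(r \<otimes> r) \<otimes> (r \<otimes> r) = g [^] (4 * N)" unfolding rr1 using g_carrier by (simp add: nat_pow_mult)
    also have "\<dots> = \<one>" using N by (simp add: g_pow_eq_one_iff)
    finally have "(r \<otimes> r) \<otimes> (r \<otimes> r) \<ominus> \<one> = \<zero>" using r by simp
    moreover have "(r \<otimes> r \<ominus> \<one>) \<otimes> (r \<otimes> r \<oplus> \<one>) = (r \<otimes> r) \<otimes> (r \<otimes> r) \<ominus> \<one>"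
      using r by algebra
    ultimately have "(r \<otimes> r \<ominus> \<one>) \<otimes> (r \<otimes> r \<oplus> \<one>) = \<zero>" by simp
    moreover have "r \<otimes> r \<ominus> \<one> \<noteq> \<zero>"
    proof -
      have "\<not> 4 * N dvd 2 * N" using N q_ge by (auto dest: dvd_imp_le)
      then show ?thesis unfolding rr1 using N by (simp add: g_pow_eq_one_iff)
    qed
    ultimately have "r \<otimes> r \<oplus> \<one> = \<zero>" using integral[of "r \<otimes> r \<ominus> \<one>" "r \<otimes> r \<oplus> \<one>"] r by auto
    then show ?thesis using r by (simp add: sum_zero_eq_neg)
  qed
  \<comment> \<open>The additive reduction of \<open>a + i b\<close> with \<open>i\<close> sent to
    \<open>- r = r^3\<close>; hence \<open>i^l\<close> goes to \<open>r^(3l)\<close>.\<close>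
  define \<phi> where "\<phi> = (\<lambda>(a::int) (b::int). add_pow F a \<one> \<ominus> add_pow F b r)"
  note add.int_pow_closed [simp]
  \<comment> \<open>The floors only read off real and imaginary parts, which are integers
    already.\<close>
  define u v where "u = (\<lambda>z. \<lfloor>Re (chi (z \<otimes> z \<ominus> g))\<rfloor>)" and "v = (\<lambda>z. \<lfloor>Im (chi (z \<otimes> z \<ominus> g))\<rfloor>)"
  have uv: "chi (z \<otimes> z \<ominus> g) = of_int (u z) + \<i> * of_int (v z)
      \<and> \<phi> (u z) (v z) = (z \<otimes> z \<ominus> g) [^] (3 * N)" if z: "z \<in> carrier F" for z
  proof -
    define y where "y = z \<otimes> z \<ominus> g"
    have y: "y \<in> carrier F" "y \<noteq> \<zero>" using z g_carrier nz[OF z] by (auto simp: y_def)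
    obtain j where j: "y = g [^] (j::nat)" by (rule nonzero_cases[OF y])
    define l where "l = j mod 4"
    have chi: "chi y = \<i> ^ l" unfolding j l_def by (simp add: chi_g_pow i_power_mod_4)
    have "y [^] (3 * N) = g [^] (N * (3 * l)) \<otimes> g [^] ((q - 1) * (3 * (j div 4)))"
    proof -
      have jl: "j = l + 4 * (j div 4)" by (simp add: l_def)
      have "j * (3 * N) = N * (3 * l) + (q - 1) * (3 * (j div 4))"
        by (subst jl) (simp add: N algebra_simps)
      then show ?thesis unfolding j using g_carrier by (simp only: nat_pow_pow nat_pow_mult)
    qed
    also have "g [^] ((q - 1) * (3 * (j div 4))) = \<one>" by (simp add: g_pow_eq_one_iff)
    also have "g [^] (N * (3 * l)) = r [^] (3 * l)" unfolding r_def using g_carrier by (simp add: nat_pow_pow)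
    finally have pw: "y [^] (3 * N) = r [^] (3 * l)" using r by simp
    have r3: "r [^] (3::nat) = \<ominus> r" using r rr by (simp add: numeral_3_eq_3 l_minus)
    have r6: "r [^] (6::nat) = \<ominus> \<one>"
    proof -
      have "r [^] (6::nat) = r [^] (3::nat) \<otimes> r [^] (3::nat)" using r by (simp add: nat_pow_mult)
      then show ?thesis using r rr by (simp add: r3 l_minus r_minus)
    qed
    have r9: "r [^] (9::nat) = r"
    proof -
      have "r [^] (9::nat) = r [^] (6::nat) \<otimes> r [^] (3::nat)" using r by (simp add: nat_pow_mult)
      then show ?thesis using r by (simp add: r3 r6 l_minus)
    qed
    have neg: "add_pow F (-1 :: int) x = \<ominus> x" if "x \<in> carrier F" for x
      using that by (simp add: add_pow_int_lt)
    have one: "add_pow F (1 :: int) x = x" if "x \<in> carrier F" for x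
      using that by (simp add: add_pow_int_ge)
    have zero: "add_pow F (0 :: int) x = \<zero>" for x
      by (simp add: add_pow_int_ge)
    have fl: "\<lfloor>- 1 :: real\<rfloor> = - 1" by (simp add: floor_eq_iff)
    have "l \<in> {0, 1, 2, 3}" unfolding l_def by auto
    then have "\<i> ^ l = of_int \<lfloor>Re (\<i> ^ l)\<rfloor> + \<i> * of_int \<lfloor>Im (\<i> ^ l)\<rfloor>
        \<and> \<phi> \<lfloor>Re (\<i> ^ l)\<rfloor> \<lfloor>Im (\<i> ^ l)\<rfloor> = r [^] (3 * l)"
      using r by (auto simp: \<phi>_def r3 r6 r9 neg one zero fl power3_eq_cube a_minus_def)
    then show ?thesis unfolding u_def v_def y_def[symmetric] chi pw .
  qed
  have "of_int A + \<i> * of_int B = (of_int (\<Sum>z\<in>carrier F. u z) + \<i> * of_int (\<Sum>z\<in>carrier F. v z) :: complex)"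
    unfolding AB[symmetric] of_int_sum sum_distrib_left sum.distrib[symmetric]
    by (rule sum.cong) (auto simp: uv)
  then have "A = (\<Sum>z\<in>carrier F. u z) \<and> B = (\<Sum>z\<in>carrier F. v z)"
    by (simp add: complex_eq_iff del: of_int_sum)
  then have "\<phi> A B = add_pow F (\<Sum>z\<in>carrier F. u z) \<one> \<oplus> add_pow F (\<Sum>z\<in>carrier F. - v z) r"
    using r by (simp add: \<phi>_def a_minus_def sum_negf add.int_pow_neg)
  also have "\<dots> = (\<Oplus>z\<in>carrier F. add_pow F (u z) \<one> \<oplus> add_pow F (- v z) r)"
    using r fin by (simp add: add_pow_sum finsum_addf Pi_def)
  also have "\<dots> = (\<Oplus>z\<in>carrier F. \<phi> (u z) (v z))"
    using r by (intro finsum_cong') (auto simp: \<phi>_def a_minus_def add.int_pow_neg)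
  also have "\<dots> = (\<Oplus>z\<in>carrier F. (z \<otimes> z \<ominus> g) [^] (3 * N))"
    using g_carrier by (intro finsum_cong') (auto simp: uv)
  also have "\<dots> = \<ominus> add_pow F (3 * N choose (2 * N)) ((\<ominus> g) [^] N)"
    by (rule finsum_quadratic_power[OF N])
  finally have eq: "\<phi> A B = \<ominus> add_pow F (3 * N choose (2 * N)) ((\<ominus> g) [^] N)" .

  have char: "add_pow F p \<one> = \<zero>"
  proof -
    \<comment> \<open>The image of \<open>p^k\<close> in the field is the \<open>k\<close>-th power
      of the image of \<open>p\<close>; the former is zero, so the latter is zero by
      integrality.\<close>
    have pow: "add_pow F (p ^ k) \<one> = (add_pow F p \<one>) [^] k"
    proof (induction k)
      case (Suc k)
      have "add_pow F (p ^ Suc k) \<one> = add_pow F p (add_pow F (p ^ k) \<one>)"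
        by (simp add: add.nat_pow_pow mult.commute)
      also have "\<dots> = add_pow F p \<one> \<otimes> add_pow F (p ^ k) \<one>"
        by (subst add_pow_ldistr) auto
      finally show ?case using Suc.IH by (simp add: m_comm)
    qed simp
    have "add_pow F q \<one> = \<zero>" using add.pow_order_eq_1[of \<one>] by (simp add: order_def card_F)
    then have "(add_pow F p \<one>) [^] k = \<zero>" using pow p(3) by simp
    then show ?thesis by (induction k) (auto simp: integral_iff)
  qed
  have "\<phi> A B = \<zero>"
  proof -
    have "add_pow F c x = \<zero>" if c: "int p dvd c" and x: "x \<in> carrier F" for c :: int and x
    proof (cases "c \<ge> 0")
      case True
      then have "p dvd nat c" using c by (metis int_dvd_int_iff nat_0_le)
      then show ?thesis
        using add_pow_multiple_of_char[OF char x] True by (simp add: add_pow_int_ge)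
    next
      case False
      then have "p dvd nat (- c)" using c by (metis dvd_minus_iff int_dvd_int_iff nat_0_le neg_0_le_iff_le nle_le)
      then show ?thesis
        using add_pow_multiple_of_char[OF char x] False by (simp add: add_pow_int_lt)
    qed
    then show ?thesis using dv r by (simp add: \<phi>_def a_minus_def)
  qed
  moreover have "(\<ominus> g) [^] N \<in> carrier F" "(\<ominus> g) [^] N \<noteq> \<zero>"
  proof -
    show "(\<ominus> g) [^] N \<noteq> \<zero>" using g_carrier g_nonzero
      by (induction N) (auto simp: integral_iff)
  qed (use g_carrier in simp)
  moreover have "add_pow F (3 * N choose (2 * N)) ((\<ominus> g) [^] N)
      = add_pow F (3 * N choose (2 * N)) \<one> \<otimes> (\<ominus> g) [^] N"
    using g_carrier by (subst add_pow_ldistr) auto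
  ultimately have c0: "add_pow F (3 * N choose (2 * N)) \<one> = \<zero>"
    using eq integral[of "add_pow F (3 * N choose (2 * N)) \<one>" "(\<ominus> g) [^] N"] by auto
  have "\<not> p dvd (3 * N choose (2 * N))"
    using N p by (intro prime_not_dvd_choose_quarters[of p N k]) auto
  \<comment> \<open>Both \<open>p\<close> and the binomial coefficient are zero in the field
    although they are coprime, so Bezout's identity gives \<open>1 = 0\<close>.\<close>
  then have "coprime p (3 * N choose (2 * N))" using p(1) by (rule prime_imp_coprime[rotated])
  then have "gcd p (3 * N choose (2 * N)) = 1" by (rule coprime_imp_gcd_eq_1)
  moreover have "p \<noteq> 0" using p(1) by auto
  ultimately obtain x y where "p * x = (3 * N choose (2 * N)) * y + 1"
    using bezout_nat[of p "3 * N choose (2 * N)"] by metis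
  then have "add_pow F (p * x) \<one> = add_pow F ((3 * N choose (2 * N)) * y) \<one> \<oplus> \<one>" by simp
  moreover have "add_pow F (p * x) \<one> = \<zero>"
    using add_pow_multiple_of_char[OF char] by simp
  moreover have "add_pow F ((3 * N choose (2 * N)) * y) \<one> = \<zero>"
    using add_pow_multiple_of_char[OF c0] by simp
  ultimately show False by simp
qed

end

section \<open>Excess of Hadamard matrices with two row sums\<close>

lemma hadamard_matI:
  assumes "H \<in> carrier_mat n n"
    and "\<And>i j. i < n \<Longrightarrow> j < n \<Longrightarrow> H $$ (i, j) \<in> {1, -1}"
    and "\<And>i k. i < n \<Longrightarrow> k < n \<Longrightarrow> (\<Sum>j<n. H $$ (i, j) * H $$ (k, j)) = (if i = k then int n else 0)"
  shows "hadamard_mat n H"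
  unfolding hadamard_mat_def
proof (intro conjI)
  show "elements_mat H \<subseteq> {1, -1}"
  proof
    fix x assume "x \<in> elements_mat H"
    then obtain i j where "i < n" "j < n" "x = H $$ (i, j)"
      using assms(1) unfolding elements_mat_def by auto
    then show "x \<in> {1, -1}" using assms(2) by blast
  qed
  show "H * transpose_mat H = int n \<cdot>\<^sub>m 1\<^sub>m n"
  proof (rule eq_matI)
    fix i j assume "i < dim_row (int n \<cdot>\<^sub>m 1\<^sub>m n)" "j < dim_col (int n \<cdot>\<^sub>m 1\<^sub>m n)"
    then have ij: "i < n" "j < n" by auto
    then have "(H * transpose_mat H) $$ (i, j) = (\<Sum>k<n. H $$ (i, k) * H $$ (j, k))"
      using assms(1) by (simp add: scalar_prod_def lessThan_atLeast0)
    then show "(H * transpose_mat H) $$ (i, j) = (int n \<cdot>\<^sub>m 1\<^sub>m n) $$ (i, j)"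
      using assms(3)[OF ij] ij by simp
  qed (use assms(1) in auto)
qed (use assms in auto)

lemma hadamard_matD:
  assumes "hadamard_mat n H"
  shows "H \<in> carrier_mat n n"
    and "i < n \<Longrightarrow> j < n \<Longrightarrow> H $$ (i, j) \<in> {1, -1}"
    and "i < n \<Longrightarrow> k < n \<Longrightarrow> (\<Sum>j<n. H $$ (i, j) * H $$ (k, j)) = (if i = k then int n else 0)"
proof -
  show H: "H \<in> carrier_mat n n" using assms by (simp add: hadamard_mat_def)
  show "H $$ (i, j) \<in> {1, -1}" if "i < n" "j < n"
  proof -
    have "H $$ (i, j) \<in> elements_mat H" using that H unfolding elements_mat_def by force
    then show ?thesis using assms unfolding hadamard_mat_def by blast
  qed
  show "(\<Sum>j<n. H $$ (i, j) * H $$ (k, j)) = (if i = k then int n else 0)" if "i < n" "k < n"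
  proof -
    have "(H * transpose_mat H) $$ (i, k) = (\<Sum>j<n. H $$ (i, j) * H $$ (k, j))"
      using H that by (simp add: scalar_prod_def lessThan_atLeast0)
    then show ?thesis using assms that by (auto simp: hadamard_mat_def split: if_splits)
  qed
qed

lemma hadamard_negate_rows_cols:
  assumes "hadamard_mat n H"
  shows "hadamard_mat n (negate_rows_cols R C H)"
proof (rule hadamard_matI)
  note H = hadamard_matD[OF assms]
  let ?s = "\<lambda>S i. if i \<in> S then -1 else (1::int)"
  have entry: "negate_rows_cols R C H $$ (i, j) = ?s R i * ?s C j * H $$ (i, j)"
    if "i < n" "j < n" for i j
    using H(1) that unfolding negate_rows_cols_def by simp
  show "negate_rows_cols R C H \<in> carrier_mat n n" using H(1) by (simp add: negate_rows_cols_def)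
  show "negate_rows_cols R C H $$ (i, j) \<in> {1, -1}" if "i < n" "j < n" for i j
    using H(2)[OF that] entry[OF that] by auto
  fix i k assume ik: "i < n" "k < n"
  have "(\<Sum>j<n. negate_rows_cols R C H $$ (i, j) * negate_rows_cols R C H $$ (k, j))
      = (\<Sum>j<n. (?s R i * ?s R k) * (H $$ (i, j) * H $$ (k, j)))"
    by (intro sum.cong refl) (simp add: entry ik)
  also have "\<dots> = (?s R i * ?s R k) * (if i = k then int n else 0)"
    using H(3)[OF ik] by (simp only: sum_distrib_left[symmetric])
  finally show "(\<Sum>j<n. negate_rows_cols R C H $$ (i, j) * negate_rows_cols R C H $$ (k, j))
      = (if i = k then int n else 0)" by auto
qed

text \<open>\<open>\<bar>H d\<bar>^2 = d^T H^T H d = n \<bar>d\<bar>^2 = n^2\<close>; symmetry of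
  \<open>H\<close> turns orthogonality of rows into orthogonality of columns.\<close>

lemma sum_squares_row_sums:
  assumes "hadamard_mat n H"
    and sym: "\<And>i j. i < n \<Longrightarrow> j < n \<Longrightarrow> H $$ (i, j) = H $$ (j, i)"
    and sgn: "\<And>j. j < n \<Longrightarrow> d j \<in> {1, - 1 :: int}"
  shows "(\<Sum>i<n. (\<Sum>j<n. H $$ (i, j) * d j)\<^sup>2) = (int n)\<^sup>2"
proof -
  have "(\<Sum>i<n. (\<Sum>j<n. H $$ (i, j) * d j)\<^sup>2)
      = (\<Sum>i<n. \<Sum>j<n. \<Sum>k<n. d j * d k * (H $$ (j, i) * H $$ (k, i)))"
    by (intro sum.cong refl) (simp add: power2_eq_square sum_product sym mult_ac)
  also have "\<dots> = (\<Sum>j<n. \<Sum>i<n. \<Sum>k<n. d j * d k * (H $$ (j, i) * H $$ (k, i)))"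
    by (rule sum.swap)
  also have "\<dots> = (\<Sum>j<n. \<Sum>k<n. \<Sum>i<n. d j * d k * (H $$ (j, i) * H $$ (k, i)))"
    by (intro sum.cong refl sum.swap)
  also have "\<dots> = (\<Sum>j<n. \<Sum>k<n. if j = k then int n else 0)"
  proof (intro sum.cong refl)
    fix j k assume "j \<in> {..<n}" "k \<in> {..<n}"
    then have jk: "j < n" "k < n" by auto
    have "(\<Sum>i<n. d j * d k * (H $$ (j, i) * H $$ (k, i))) = d j * d k * (if j = k then int n else 0)"
      using hadamard_matD(3)[OF assms(1) jk] by (simp only: sum_distrib_left[symmetric])
    also have "\<dots> = (if j = k then int n else 0)" using sgn[OF jk(1)] by auto
    finally show "(\<Sum>i<n. d j * d k * (H $$ (j, i) * H $$ (k, i))) = (if j = k then int n else 0)" .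
  qed
  finally show ?thesis by (simp add: power2_eq_square)
qed

text \<open>The sum of the squared row sums is \<open>n\<^sup>2\<close>, so once only two absolute values occur,
  their frequencies and hence the excess are determined.\<close>

lemma biregular_negation:
  fixes a b E :: int
  assumes H: "hadamard_mat n H"
    and sym: "\<And>i j. i < n \<Longrightarrow> j < n \<Longrightarrow> H $$ (i, j) = H $$ (j, i)"
    and sgn: "\<And>j. j < n \<Longrightarrow> d j \<in> {1, - 1 :: int}"
    and val: "\<And>i. i < n \<Longrightarrow> \<bar>\<Sum>j<n. H $$ (i, j) * d j\<bar> \<in> {a, b}"
    and ab: "0 \<le> a" "a < b"
    and E: "E * (a + b) = int n * (int n + a * b)" "int n * a < E" "E < int n * b"
  shows "\<exists>R C. R \<subseteq> {0..<n} \<and> C \<subseteq> {0..<n} \<and>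
    (let H' = negate_rows_cols R C H in hadamard_mat n H' \<and> biregular H' \<and> excess H' = E)"
proof -
  define r where "r = (\<lambda>i. \<Sum>j<n. H $$ (i, j) * d j)"
  \<comment> \<open>Negating the columns in \<open>C\<close> realises the sign vector
    \<open>d\<close>; negating the rows in \<open>R\<close> replaces each row sum by its absolute
    value.\<close>
  define R where "R = {i \<in> {0..<n}. r i < 0}"
  define C where "C = {j \<in> {0..<n}. d j = -1}"
  define H' where "H' = negate_rows_cols R C H"
  have H': "hadamard_mat n H'" unfolding H'_def by (rule hadamard_negate_rows_cols[OF H])
  then have car: "H' \<in> carrier_mat n n" by (rule hadamard_matD)
  have Hc: "H \<in> carrier_mat n n" using H by (rule hadamard_matD)
  have row: "(\<Sum>j<n. H' $$ (i, j)) = \<bar>r i\<bar>" if i: "i < n" for i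
  proof -
    have "H' $$ (i, j) = (if i \<in> R then -1 else 1) * (H $$ (i, j) * d j)" if j: "j < n" for j
      using sgn[OF j] i j Hc unfolding H'_def negate_rows_cols_def by (auto simp: C_def)
    then have "(\<Sum>j<n. H' $$ (i, j)) = (if i \<in> R then -1 else 1) * r i"
      unfolding r_def sum_distrib_left by (intro sum.cong refl) auto
    then show ?thesis using i by (auto simp: R_def)
  qed
  have ex: "excess H' = (\<Sum>i<n. \<bar>r i\<bar>)"
    using car row by (simp add: excess_def)
  \<comment> \<open>Each summand is
    \<open>(\<bar>r i\<bar> - a) * (\<bar>r i\<bar> - b) = 0\<close>. With the known sum of squares
    this becomes a linear equation for the excess.\<close>
  have "(\<Sum>i<n. \<bar>r i\<bar> * \<bar>r i\<bar> - (a + b) * \<bar>r i\<bar> + a * b) = 0"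
  proof (rule sum.neutral, rule ballI)
    fix i assume "i \<in> {..<n}"
    then have "\<bar>r i\<bar> = a \<or> \<bar>r i\<bar> = b" using val unfolding r_def by auto
    moreover have "\<bar>r i\<bar> * \<bar>r i\<bar> - (a + b) * \<bar>r i\<bar> + a * b = (\<bar>r i\<bar> - a) * (\<bar>r i\<bar> - b)"
      by (simp add: algebra_simps)
    ultimately show "\<bar>r i\<bar> * \<bar>r i\<bar> - (a + b) * \<bar>r i\<bar> + a * b = 0" by auto
  qed
  moreover have "(\<Sum>i<n. \<bar>r i\<bar> * \<bar>r i\<bar>) = (int n)\<^sup>2"
    using sum_squares_row_sums[OF H sym sgn] unfolding r_def by (simp add: power2_eq_square)
  ultimately have "(int n)\<^sup>2 - (a + b) * excess H' + int n * (a * b) = 0"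
    unfolding ex by (simp add: sum.distrib sum_subtractf sum_distrib_left)
  then have "excess H' * (a + b) = E * (a + b)" using E(1)
    by (simp add: power2_eq_square algebra_simps)
  then have exE: "excess H' = E" using ab by simp
  have rv: "\<bar>r i\<bar> \<in> {a, b}" if "i < n" for i using val[OF that] by (simp only: r_def)
  \<comment> \<open>If one value were missing, all row sums would be equal and \<open>E\<close>
    would be \<open>n * a\<close> or \<open>n * b\<close>, which the strict bounds exclude. So
    exactly two values occur.\<close>
  have "\<exists>i<n. \<bar>r i\<bar> = c" if "c \<in> {a, b}" for c
  proof (rule ccontr)
    assume no: "\<not> (\<exists>i<n. \<bar>r i\<bar> = c)"
    define c' where "c' = (if c = a then b else a)"
    have "\<bar>r i\<bar> = c'" if "i < n" for i
      using rv[OF that] no that \<open>c \<in> {a, b}\<close> unfolding c'_def by auto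
    then have "E = int n * c'" unfolding exE[symmetric] ex by simp
    then show False using E(2,3) by (auto simp: c'_def split: if_splits)
  qed
  then have vals: "(\<lambda>i. \<bar>r i\<bar>) ` {..<n} = {a, b}" using rv by (force simp: image_iff)
  have "set\<^sub>v (H' *\<^sub>v ones_vec (dim_col H')) = (\<lambda>i. \<bar>r i\<bar>) ` {..<n}"
  proof -
    have "(H' *\<^sub>v ones_vec (dim_col H')) $ i = \<bar>r i\<bar>" if "i < n" for i
      using car row[OF that] that by (simp add: ones_vec_def scalar_prod_def lessThan_atLeast0)
    moreover have "dim_vec (H' *\<^sub>v ones_vec (dim_col H')) = n" using car by simp
    ultimately show ?thesis unfolding vec_set_def by (force simp: image_iff)
  qed
  then have "biregular H'" unfolding biregular_def Let_def vals using ab by auto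
  then show ?thesis using H' exE unfolding H'_def
    by (intro exI[of _ R] exI[of _ C]) (auto simp: R_def C_def Let_def)
qed

section \<open>Evaluation of the excess bound\<close>

text \<open>From \<open>(2m + 1)^2 < n < (2m + 2)^2\<close> one gets \<open>k = 2m\<close>. The
  distances of \<open>n\<close> to \<open>k^2\<close> and \<open>(k + 2)^2\<close> are
  \<open>4m + 4\<close> and \<open>4m\<close>, so \<open>t = 2m - 2\<close>. The quotient defining
  \<open>s\<close> is then \<open>4mn / (16m) = n / 4\<close>, an integer, so the floor loses
  nothing and the bound is \<open>n (2m + 2) - n\<close>.\<close>

lemma excess_bound_eq:
  fixes m :: int
  assumes m: "m \<ge> 1" and n: "int n = 4 * (m\<^sup>2 + m + 1)"
  shows "excess_bound n = int n * (2 * m + 1)"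
proof -
  have rn: "real n = 4 * ((real_of_int m)\<^sup>2 + real_of_int m + 1)"
    using arg_cong[OF n, of real_of_int] by simp
  have s1: "real_of_int (2 * m + 1) \<le> sqrt (real n)"
    by (rule real_le_rsqrt) (use m in \<open>simp add: rn power2_eq_square algebra_simps\<close>)
  have s2: "sqrt (real n) < real_of_int (2 * m + 2)"
    by (rule real_less_lsqrt) (use m in \<open>simp_all add: rn power2_eq_square algebra_simps\<close>)
  have k: "excess_k n = 2 * m"
    unfolding excess_k_def
  proof (rule the_equality)
    show "even (2 * m) \<and> real_of_int (2 * m) \<le> sqrt (real n) \<and> sqrt (real n) < real_of_int (2 * m + 2)"
      using s1 s2 by simp
    fix k assume h: "even k \<and> real_of_int k \<le> sqrt (real n) \<and> sqrt (real n) < real_of_int (k + 2)"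
    then have "real_of_int k < real_of_int (2 * m + 2)" "real_of_int (2 * m + 1) < real_of_int (k + 2)"
      using s1 s2 by linarith+
    then have "k < 2 * m + 2" "2 * m + 1 < k + 2" by linarith+
    moreover have "even k" using h by blast
    ultimately show "k = 2 * m" by presburger
  qed
  have "\<bar>int n - (2 * m)\<^sup>2\<bar> = 4 * m + 4" "\<bar>int n - (2 * m + 2)\<^sup>2\<bar> = 4 * m"
    using m unfolding n by (simp_all add: power2_eq_square algebra_simps)
  then have t: "excess_t n = 2 * m - 2"
    using k by (simp add: excess_t_def Let_def)
  have "(2 * m - 2 + 4)\<^sup>2 - int n = 4 * m"
    unfolding n by (simp add: power2_eq_square algebra_simps)
  then have "real_of_int (int n * ((2 * m - 2 + 4)\<^sup>2 - int n)) / real_of_int (8 * (2 * m - 2) + 16)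
      = real_of_int (m\<^sup>2 + m + 1)"
    using m unfolding n by (simp add: field_simps)
  then have s: "excess_s n = m\<^sup>2 + m + 1"
    unfolding excess_s_def t Let_def by (simp only: floor_of_int)
  show ?thesis unfolding excess_bound_def t s using n by (simp add: algebra_simps)
qed

section \<open>The Paley matrix\<close>

lemma sum_lessThan_add:
  fixes f :: "nat \<Rightarrow> 'c :: comm_monoid_add"
  shows "(\<Sum>j<a + b. f j) = (\<Sum>j<a. f j) + (\<Sum>j<b. f (a + j))"
  by (induction b) (simp_all add: add.assoc)

context paley_field
begin

text \<open>An index of \<open>H\<close> encodes a point of the projective line (\<open>None\<close> is infinity) together with
  one of its two copies: \<open>0, 1\<close> are the copies of infinity, then come the first copies and finally
  the second copies of the field elements.\<close>

definition index_point :: "(nat \<Rightarrow> 'a) \<Rightarrow> nat \<Rightarrow> 'a option" where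
  "index_point e i = (if i < 2 then None else if i < q + 2 then Some (e (i - 2)) else Some (e (i - (q + 2))))"

definition second_copy :: "nat \<Rightarrow> bool" where
  "second_copy i \<longleftrightarrow> i = 1 \<or> i \<ge> q + 2"

text \<open>The entry of \<open>C\<close> tensored with \<open>(1, 1; 1, -1)\<close> plus the
  identity tensored with \<open>(1, -1; -1, -1)\<close>; \<open>b\<close> and \<open>c\<close> tell
  whether row and column belong to the second copy.\<close>

definition block_entry :: "'a option \<Rightarrow> bool \<Rightarrow> 'a option \<Rightarrow> bool \<Rightarrow> int" where
  "block_entry x b y c = conference x y * (if b \<and> c then -1 else 1)
     + (if x = y then (if b \<or> c then -1 else 1) else 0)"

lemma index_cases:
  assumes "i < 2 * q + 2"
  obtains "i = 0" | "i = 1" | a where "i = 2 + a" "a < q" | a where "i = q + 2 + a" "a < q"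
proof -
  consider "i = 0" | "i = 1" | "2 \<le> i" "i < q + 2" | "q + 2 \<le> i" by linarith
  then show thesis
  proof cases
    case 3
    then show thesis using that(3)[of "i - 2"] by auto
  next
    case 4
    then show thesis using that(4)[of "i - (q + 2)"] assms by auto
  qed (use that in auto)
qed

lemma index_point_simps [simp]:
  "index_point e 0 = None" "index_point e (Suc 0) = None"
  "a < q \<Longrightarrow> index_point e (Suc (Suc a)) = Some (e a)" "a < q \<Longrightarrow> index_point e (Suc (Suc (q + a))) = Some (e a)"
  by (auto simp: index_point_def)

lemma second_copy_simps [simp]:
  "\<not> second_copy 0" "second_copy (Suc 0)" "a < q \<Longrightarrow> \<not> second_copy (Suc (Suc a))" "second_copy (Suc (Suc (q + a)))"
  by (auto simp: second_copy_def)

lemma index_point_in_points: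
  assumes "bij_betw e {0..<q} (carrier F)" "i < 2 * q + 2"
  shows "index_point e i \<in> points"
  using assms(2)
proof (cases rule: index_cases)
  case (3 a)
  then show ?thesis using bij_betwE[OF assms(1)] by (simp add: points_def)
next
  case (4 a)
  then show ?thesis using bij_betwE[OF assms(1)] by (simp add: points_def)
qed (simp_all add: points_def)

lemma index_eq_iff:
  assumes e: "bij_betw e {0..<q} (carrier F)" and i: "i < 2 * q + 2" and k: "k < 2 * q + 2"
  shows "i = k \<longleftrightarrow> index_point e i = index_point e k \<and> second_copy i = second_copy k"
proof -
  have inj: "e a = e b \<longleftrightarrow> a = b" if "a < q" "b < q" for a b
    using bij_betw_imp_inj_on[OF e] that by (auto simp: inj_on_def)
  show ?thesis
    using i k by (elim index_cases) (simp_all add: inj)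
qed

lemma sum_index:
  assumes e: "bij_betw e {0..<q} (carrier F)"
  shows "(\<Sum>j<2 * q + 2. f (index_point e j) (second_copy j)) = (\<Sum>x\<in>points. f x False + f x True :: int)"
proof -
  have re: "(\<Sum>j<q. f (Some (e j)) b) = (\<Sum>x\<in>carrier F. f (Some x) b)" for b
    using sum.reindex_bij_betw[OF e, of "\<lambda>x. f (Some x) b"] by (simp add: lessThan_atLeast0)
  have "(\<Sum>j<2 * q + 2. f (index_point e j) (second_copy j))
      = (\<Sum>j<2. f (index_point e j) (second_copy j)) + (\<Sum>j<q. f (index_point e (2 + j)) (second_copy (2 + j)))
        + (\<Sum>j<q. f (index_point e (q + 2 + j)) (second_copy (q + 2 + j)))"
    using sum_lessThan_add[of "\<lambda>j. f (index_point e j) (second_copy j)" "2 + q" q]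
      sum_lessThan_add[of "\<lambda>j. f (index_point e j) (second_copy j)" 2 q]
    by (simp add: mult_2 add_ac)
  also have "(\<Sum>j<q. f (index_point e (2 + j)) (second_copy (2 + j))) = (\<Sum>j<q. f (Some (e j)) False)"
    by (intro sum.cong refl) simp
  also have "(\<Sum>j<q. f (index_point e (q + 2 + j)) (second_copy (q + 2 + j))) = (\<Sum>j<q. f (Some (e j)) True)"
    by (intro sum.cong refl) simp
  also have "(\<Sum>j<2. f (index_point e j) (second_copy j)) = f None False + f None True"
    by (simp add: numeral_2_eq_2)
  finally show ?thesis by (simp add: re sum_points sum.distrib)
qed

lemma paley_hadamard_carrier: "paley_hadamard F q e \<in> carrier_mat (2 * q + 2) (2 * q + 2)"
  unfolding paley_hadamard_def Let_def
  by (auto simp: paley_mat_def ones_mat_def mat_of_rows_list_def)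

text \<open>Checked block by block: off the diagonal the large blocks are
  \<open>M, M, M, - M\<close>, and their diagonal entries \<open>1, -1, -1, -1\<close> repeat the
  corner block.\<close>

lemma paley_hadamard_entry:
  assumes e: "bij_betw e {0..<q} (carrier F)" and i: "i < 2 * q + 2" and j: "j < 2 * q + 2"
  shows "paley_hadamard F q e $$ (i, j) = block_entry (index_point e i) (second_copy i) (index_point e j) (second_copy j)"
proof -
  have ec: "e a \<in> carrier F" if "a < q" for a using bij_betwE[OF e] that by auto
  have inj: "e a = e b \<longleftrightarrow> a = b" if "a < q" "b < q" for a b
    using bij_betw_imp_inj_on[OF e] that by (auto simp: inj_on_def)
  have M: "paley_mat F q e $$ (a, b) = conference (Some (e a)) (Some (e b))" if "a < q" "b < q" for a b
    using that ec inj by (auto simp: paley_mat_def rho_def)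
  have dims: "dim_row (paley_mat F q e) = q" "dim_col (paley_mat F q e) = q"
    "dim_row (ones_mat a b) = a" "dim_col (ones_mat a b) = b" for a b
    by (simp_all add: paley_mat_def ones_mat_def)
  have one: "ones_mat r c $$ (a, b) = 1" if "a < r" "b < c" for a b r c
    using that by (simp add: ones_mat_def)
  show ?thesis
    using i j unfolding paley_hadamard_def Let_def
    by (elim index_cases)
       (auto simp: dims one M block_entry_def inj mat_of_rows_list_def numeral_2_eq_2)
qed

section \<open>Symmetry and orthogonality of the Paley matrix\<close>

lemma block_entry_sym:
  assumes "x \<in> points" "y \<in> points"
  shows "block_entry x b y c = block_entry y c x b"
  using conference_sym[OF assms] by (auto simp: block_entry_def)

lemma block_entry_values:
  assumes "x \<in> points" "y \<in> points"
  shows "block_entry x b y c \<in> {1, -1}"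
  using conference_diag[OF assms(1)] conference_abs[OF assms] by (cases "x = y") (auto simp: block_entry_def)

lemma sum_delta_points:
  assumes "x \<in> points"
  shows "(\<Sum>y\<in>points. if x = y then f y else 0 :: int) = f x"
  using assms by simp

text \<open>The matrices \<open>s = (1, 1; 1, -1)\<close> and \<open>t = (1, -1; -1, -1)\<close>
  satisfy \<open>s s^T = t t^T = 2 I\<close> and \<open>s t^T + t s^T = 0\<close>. As
  \<open>C\<close> is symmetric, the mixed terms cancel and \<open>C C^T = q I\<close> leaves
  \<open>2q + 2\<close> on the diagonal. \<open>S\<close>, \<open>T\<close>, \<open>U\<close>,
  \<open>V\<close> are entries of these four products.\<close>

lemma block_entry_orth:
  assumes x: "x \<in> points" and x': "x' \<in> points"
  shows "(\<Sum>y\<in>points. block_entry x b y False * block_entry x' b' y False + block_entry x b y True * block_entry x' b' y True)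
    = (if x = x' \<and> b = b' then 2 * int q + 2 else 0)"
proof -
  define s where "s = (\<lambda>b c. if b \<and> c then -1 else (1::int))"
  define t where "t = (\<lambda>b c. if b \<or> c then -1 else (1::int))"
  define S where "S = s b False * s b' False + s b True * s b' True"
  define T where "T = t b False * t b' False + t b True * t b' True"
  define U where "U = s b False * t b' False + s b True * t b' True"
  define V where "V = t b False * s b' False + t b True * s b' True"
  have "(\<Sum>y\<in>points. block_entry x b y False * block_entry x' b' y False + block_entry x b y True * block_entry x' b' y True)
      = (\<Sum>y\<in>points. S * (conference x y * conference x' y) + (if x' = y then U * conference x y else 0)
          + (if x = y then V * conference x' y else 0) + (if x = y then (if x' = y then T else 0) else 0))"
    by (intro sum.cong refl)
       (auto simp: block_entry_def S_def T_def U_def V_def s_def t_def algebra_simps)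
  also have "\<dots> = S * (if x = x' then int q else 0) + U * conference x x' + V * conference x' x
      + (if x = x' then T else 0)"
    using sum_delta_points[OF x', of "\<lambda>y. U * conference x y"] sum_delta_points[OF x, of "\<lambda>y. V * conference x' y"]
      sum_delta_points[OF x, of "\<lambda>y. if x' = y then T else 0"]
      conference_orth[OF x x']
    by (auto simp: sum.distrib simp flip: sum_distrib_left)
  also have "conference x' x = conference x x'" by (rule conference_sym[OF x' x])
  also have "S * (if x = x' then int q else 0) + U * conference x x' + V * conference x x' + (if x = x' then T else 0)
      = (if x = x' \<and> b = b' then 2 * int q + 2 else 0)"
  proof -
    have "U + V = 0" by (auto simp: U_def V_def s_def t_def)
    then have "U * conference x x' + V * conference x x' = 0" by (metis distrib_right mult_zero_left)
    moreover have "S = (if b = b' then 2 else 0)" "T = (if b = b' then 2 else 0)"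
      by (auto simp: S_def T_def s_def t_def)
    ultimately show ?thesis by (auto split: if_splits)
  qed
  finally show ?thesis .
qed

lemma hadamard_paley:
  assumes e: "bij_betw e {0..<q} (carrier F)"
  shows "hadamard_mat (2 * q + 2) (paley_hadamard F q e)"
proof (rule hadamard_matI[OF paley_hadamard_carrier])
  note P = index_point_in_points[OF e]
  fix i k assume i: "i < 2 * q + 2" and k: "k < 2 * q + 2"
  show "paley_hadamard F q e $$ (i, k) \<in> {1, -1}"
    unfolding paley_hadamard_entry[OF e i k] by (rule block_entry_values[OF P[OF i] P[OF k]])
  have "(\<Sum>j<2 * q + 2. paley_hadamard F q e $$ (i, j) * paley_hadamard F q e $$ (k, j))
      = (\<Sum>j<2 * q + 2. block_entry (index_point e i) (second_copy i) (index_point e j) (second_copy j) * block_entry (index_point e k) (second_copy k) (index_point e j) (second_copy j))"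
    by (intro sum.cong refl) (simp only: lessThan_iff paley_hadamard_entry[OF e] i k)
  also have "\<dots> = (if index_point e i = index_point e k \<and> second_copy i = second_copy k then 2 * int q + 2 else 0)"
    using sum_index[OF e, of "\<lambda>y c. block_entry (index_point e i) (second_copy i) y c * block_entry (index_point e k) (second_copy k) y c"]
      block_entry_orth[OF P[OF i] P[OF k]] by simp
  also have "\<dots> = (if i = k then int (2 * q + 2) else 0)"
    using index_eq_iff[OF e i k] by simp
  finally show "(\<Sum>j<2 * q + 2. paley_hadamard F q e $$ (i, j) * paley_hadamard F q e $$ (k, j))
      = (if i = k then int (2 * q + 2) else 0)" .
qed

section \<open>Row sums after negating columns\<close>

definition wt_re :: "'a option \<Rightarrow> int" where "wt_re x = \<lfloor>Re (wt x)\<rfloor>"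
definition wt_im :: "'a option \<Rightarrow> int" where "wt_im x = \<lfloor>Im (wt x)\<rfloor>"

lemma wt_parts:
  assumes "x \<in> points"
  shows "wt x = of_int (wt_re x) + \<i> * of_int (wt_im x)"
    and "(wt_re x, wt_im x) \<in> {(1, 0), (0, 1), (-1, 0), (0, -1)}"
proof -
  have "\<lfloor>- 1 :: real\<rfloor> = - 1" by (simp add: floor_eq_iff)
  then show "wt x = of_int (wt_re x) + \<i> * of_int (wt_im x)"
    and "(wt_re x, wt_im x) \<in> {(1, 0), (0, 1), (-1, 0), (0, -1)}"
    using wt_cases[OF assms] unfolding wt_re_def wt_im_def by auto
qed

text \<open>Real and imaginary parts of \<open>C w = J * cnj w\<close> for
  \<open>w = u + i v\<close>, using
  \<open>(A + i B)(u - i v) = (A u + B v) + i (B u - A v)\<close>.\<close>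

lemma quartic_sum_parts:
  obtains A B :: int where "quartic_sum = of_int A + \<i> * of_int B" "int q = A\<^sup>2 + B\<^sup>2"
    "\<forall>x\<in>points. (\<Sum>y\<in>points. conference x y * wt_re y) = A * wt_re x + B * wt_im x"
    "\<forall>x\<in>points. (\<Sum>y\<in>points. conference x y * wt_im y) = B * wt_re x - A * wt_im x"
proof -
  define A where "A = (\<Sum>y\<in>points. conference None y * wt_re y)"
  define B where "B = (\<Sum>y\<in>points. conference None y * wt_im y)"
  have split: "(\<Sum>y\<in>points. of_int (conference x y) * wt y)
      = of_int (\<Sum>y\<in>points. conference x y * wt_re y) + \<i> * of_int (\<Sum>y\<in>points. conference x y * wt_im y)" for x
    unfolding of_int_sum of_int_mult sum_distrib_left sum.distrib[symmetric]
    by (intro sum.cong refl) (simp add: wt_parts(1) algebra_simps)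
  have JAB: "quartic_sum = of_int A + \<i> * of_int B"
    using split[of None] unfolding conference_wt_None A_def B_def .
  have "of_int (A\<^sup>2 + B\<^sup>2) = (of_int (int q) :: complex)"
    using quartic_sum_norm unfolding JAB by (simp add: power2_eq_square algebra_simps)
  then have qAB: "int q = A\<^sup>2 + B\<^sup>2" by (simp only: of_int_eq_iff)
  have "of_int (\<Sum>y\<in>points. conference x y * wt_re y) + \<i> * of_int (\<Sum>y\<in>points. conference x y * wt_im y)
      = (of_int (A * wt_re x + B * wt_im x) + \<i> * of_int (B * wt_re x - A * wt_im x) :: complex)"
    if x: "x \<in> points" for x
    using conference_wt[OF x] unfolding split[symmetric] JAB wt_parts(1)[OF x]
    by (simp add: algebra_simps)
  then have "(\<Sum>y\<in>points. conference x y * wt_re y) = A * wt_re x + B * wt_im x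
      \<and> (\<Sum>y\<in>points. conference x y * wt_im y) = B * wt_re x - A * wt_im x" if "x \<in> points" for x
    using that by (simp only: complex_eq_iff) (simp del: of_int_sum of_int_add of_int_mult of_int_diff)
  then show thesis using that[OF JAB qAB] by blast
qed

text \<open>With signs \<open>u + v\<close> and \<open>u - v\<close> on the two copies, a first-copy
  row gives \<open>2 C u + 2 v = 2 (A u + (B + 1) v)\<close> and a second-copy row gives
  \<open>2 C v - 2 u = 2 ((B - 1) u - A v)\<close>. At each point one of \<open>u\<close>,
  \<open>v\<close> is zero and the other is a sign.\<close>

lemma paley_row_sums:
  assumes e: "bij_betw e {0..<q} (carrier F)"
    and A: "\<forall>x\<in>points. (\<Sum>y\<in>points. conference x y * wt_re y) = A * wt_re x + B * wt_im x"
    and B: "\<forall>x\<in>points. (\<Sum>y\<in>points. conference x y * wt_im y) = B * wt_re x - A * wt_im x"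
    and i: "i < 2 * q + 2"
  defines "d \<equiv> \<lambda>j. if second_copy j then wt_re (index_point e j) - wt_im (index_point e j) else wt_re (index_point e j) + wt_im (index_point e j)"
  shows "\<bar>\<Sum>j<2 * q + 2. paley_hadamard F q e $$ (i, j) * d j\<bar> \<in> {2 * \<bar>A\<bar>, 2 * \<bar>B + 1\<bar>, 2 * \<bar>B - 1\<bar>}"
proof -
  define x where "x = index_point e i"
  have x: "x \<in> points" unfolding x_def by (rule index_point_in_points[OF e i])
  define D where "D = (\<lambda>y c. if c then wt_re y - wt_im y else wt_re y + wt_im y)"
  have "(\<Sum>j<2 * q + 2. paley_hadamard F q e $$ (i, j) * d j)
      = (\<Sum>j<2 * q + 2. block_entry x (second_copy i) (index_point e j) (second_copy j) * D (index_point e j) (second_copy j))"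
    by (intro sum.cong refl) (simp only: lessThan_iff paley_hadamard_entry[OF e i] x_def d_def D_def)
  also have "\<dots> = (\<Sum>y\<in>points. block_entry x (second_copy i) y False * D y False + block_entry x (second_copy i) y True * D y True)"
    by (rule sum_index[OF e, of "\<lambda>y c. block_entry x (second_copy i) y c * D y c"])
  also have "\<dots> = (if second_copy i then 2 * (\<Sum>y\<in>points. conference x y * wt_im y) - 2 * wt_re x
      else 2 * (\<Sum>y\<in>points. conference x y * wt_re y) + 2 * wt_im x)"
  proof (cases "second_copy i")
    case True
    have "(\<Sum>y\<in>points. block_entry x (second_copy i) y False * D y False + block_entry x (second_copy i) y True * D y True)
        = (\<Sum>y\<in>points. 2 * (conference x y * wt_im y) + (if x = y then - 2 * wt_re y else 0))"
      using True by (intro sum.cong refl) (auto simp: block_entry_def D_def algebra_simps)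
    then show ?thesis using True sum_delta_points[OF x, of "\<lambda>y. - 2 * wt_re y"]
      by (simp add: sum.distrib sum_distrib_left)
  next
    case False
    have "(\<Sum>y\<in>points. block_entry x (second_copy i) y False * D y False + block_entry x (second_copy i) y True * D y True)
        = (\<Sum>y\<in>points. 2 * (conference x y * wt_re y) + (if x = y then 2 * wt_im y else 0))"
      using False by (intro sum.cong refl) (auto simp: block_entry_def D_def algebra_simps)
    then show ?thesis using False sum_delta_points[OF x, of "\<lambda>y. 2 * wt_im y"]
      by (simp add: sum.distrib sum_distrib_left)
  qed
  also have "\<dots> = (if second_copy i then 2 * ((B - 1) * wt_re x - A * wt_im x) else 2 * (A * wt_re x + (B + 1) * wt_im x))"
    using bspec[OF A x] bspec[OF B x] by (simp add: algebra_simps)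
  finally have eq: "(\<Sum>j<2 * q + 2. paley_hadamard F q e $$ (i, j) * d j) = \<dots>" .
  show ?thesis unfolding eq using wt_parts(2)[OF x] by (auto simp: abs_if)
qed

lemma paley_max_excess:
  assumes e: "bij_betw e {0..<q} (carrier F)"
    and m: "m \<ge> 1" "int q = 2 * m\<^sup>2 + 2 * m + 1"
    and p: "prime p" "q = p ^ k"
  shows "\<exists>R C. R \<subseteq> {0..<2 * q + 2} \<and> C \<subseteq> {0..<2 * q + 2} \<and>
    (let H' = negate_rows_cols R C (paley_hadamard F q e)
     in hadamard_mat (2 * q + 2) H' \<and> biregular H' \<and> max_excess (2 * q + 2) H')"
proof -
  let ?n = "2 * q + 2" and ?H = "paley_hadamard F q e"
  have n: "int ?n = 4 * (m\<^sup>2 + m + 1)" using m(2) by simp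
  have q2: "int p ^ k = m\<^sup>2 + (m + 1)\<^sup>2"
    using m(2) arg_cong[OF p(2), of int] by (simp add: power2_eq_square algebra_simps)
  have kpos: "k > 0" using p(2) q_ge by (cases k) auto
  have odd: "odd p"
  proof -
    have "odd q" using q_mod by presburger
    then show ?thesis using p(2) kpos by simp
  qed
  have cop: "coprime m (m + 1)" by simp
  \<comment> \<open>The congruence for \<open>q\<close> alone would admit even powers of primes
    congruent to 3 modulo 4; the coprime squares \<open>m^2\<close> and \<open>(m + 1)^2\<close>
    rule these out.\<close>
  have p4: "p mod 4 = 1"
  proof (rule prime_dvd_sum_squares_mod_4[OF p(1) odd])
    show "int p dvd m\<^sup>2 + (m + 1)\<^sup>2" unfolding q2[symmetric] using kpos by simp
    show "\<not> int p dvd m"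
    proof
      assume h: "int p dvd m"
      then have "int p dvd m\<^sup>2" by (simp add: power2_eq_square)
      moreover have "int p dvd m\<^sup>2 + (m + 1)\<^sup>2" unfolding q2[symmetric] using kpos by simp
      ultimately have "int p dvd (m + 1)\<^sup>2" by (simp add: dvd_add_right_iff)
      then have "int p dvd m + 1" using p(1) by (meson prime_dvd_power prime_nat_int_transfer)
      with h have "int p dvd 1" by (simp add: dvd_add_right_iff)
      then show False using p(1) by (simp add: prime_nat_iff)
    qed
  qed
  obtain A B :: int where JAB: "quartic_sum = of_int A + \<i> * of_int B" and qAB: "int q = A\<^sup>2 + B\<^sup>2"
    and rows: "\<forall>x\<in>points. (\<Sum>y\<in>points. conference x y * wt_re y) = A * wt_re x + B * wt_im x"
      "\<forall>x\<in>points. (\<Sum>y\<in>points. conference x y * wt_im y) = B * wt_re x - A * wt_im x"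
    by (rule quartic_sum_parts)
  have "\<not> (int p dvd A \<and> int p dvd B)"
    using JAB square_minus_g_nonzero unfolding quartic_sum_def
    by (intro quartic_sum_not_divisible[OF p(1) p4 p(2)])
  moreover have "int p ^ k = A\<^sup>2 + B\<^sup>2" using qAB p(2) by simp
  ultimately have AB: "(\<bar>A\<bar> = \<bar>m\<bar> \<and> \<bar>B\<bar> = \<bar>m + 1\<bar>) \<or> (\<bar>A\<bar> = \<bar>m + 1\<bar> \<and> \<bar>B\<bar> = \<bar>m\<bar>)"
    using sum_squares_prime_power_unique[OF p(1) odd _ q2 cop] by blast
  define d where "d = (\<lambda>j. if second_copy j then wt_re (index_point e j) - wt_im (index_point e j) else wt_re (index_point e j) + wt_im (index_point e j))"
  have sgn: "d j \<in> {1, -1}" if "j < ?n" for j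
    using wt_parts(2)[OF index_point_in_points[OF e that]] unfolding d_def by auto
  have val: "\<bar>\<Sum>j<?n. ?H $$ (i, j) * d j\<bar> \<in> {2 * \<bar>A\<bar>, 2 * \<bar>B + 1\<bar>, 2 * \<bar>B - 1\<bar>}" if "i < ?n" for i
    using paley_row_sums[OF e rows that] unfolding d_def .
  have sym: "?H $$ (i, j) = ?H $$ (j, i)" if "i < ?n" "j < ?n" for i j
    using paley_hadamard_entry[OF e] block_entry_sym index_point_in_points[OF e] that by metis
  note had = hadamard_paley[OF e]
  note main = biregular_negation[OF had sym sgn, where E = "int ?n * (2 * m + 1)"]
  have E: "int ?n * a < int ?n * (2 * m + 1)" if "a < 2 * m + 1" for a
    using that by (intro mult_strict_left_mono) auto
  have E': "int ?n * (2 * m + 1) < int ?n * a" if "2 * m + 1 < a" for a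
    using that by (intro mult_strict_left_mono) auto
  have "\<exists>R C. R \<subseteq> {0..<?n} \<and> C \<subseteq> {0..<?n} \<and>
    (let H' = negate_rows_cols R C ?H
     in hadamard_mat ?n H' \<and> biregular H' \<and> excess H' = int ?n * (2 * m + 1))"
    using AB
  proof
    assume h: "\<bar>A\<bar> = \<bar>m\<bar> \<and> \<bar>B\<bar> = \<bar>m + 1\<bar>"
    show ?thesis
    \<comment> \<open>Here \<open>\<bar>B\<bar> = m + 1\<close>, so \<open>B + 1\<close> and
      \<open>B - 1\<close> have absolute values \<open>m\<close> and \<open>m + 2\<close> in some
      order.\<close>
    proof (rule main[where a = "2 * m" and b = "2 * m + 4"])
      show "\<bar>\<Sum>j<?n. ?H $$ (i, j) * d j\<bar> \<in> {2 * m, 2 * m + 4}" if "i < ?n" for i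
      proof -
        have "{2 * \<bar>A\<bar>, 2 * \<bar>B + 1\<bar>, 2 * \<bar>B - 1\<bar>} \<subseteq> {2 * m, 2 * m + 4}"
          using h m(1) by (auto simp: abs_if split: if_splits)
        then show ?thesis using val[OF that] by blast
      qed
      show "int ?n * (2 * m + 1) * (2 * m + (2 * m + 4)) = int ?n * (int ?n + 2 * m * (2 * m + 4))"
        unfolding n by (simp add: power2_eq_square algebra_simps)
    qed (use m(1) E E' in auto)
  next
    assume h: "\<bar>A\<bar> = \<bar>m + 1\<bar> \<and> \<bar>B\<bar> = \<bar>m\<bar>"
    show ?thesis
    \<comment> \<open>Here \<open>\<bar>B\<bar> = m\<close>, so the absolute values are
      \<open>m - 1\<close> and \<open>m + 1\<close>. For \<open>m = 1\<close> the smaller row sum is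
      0, which biregularity permits.\<close>
    proof (rule main[where a = "2 * m - 2" and b = "2 * m + 2"])
      show "\<bar>\<Sum>j<?n. ?H $$ (i, j) * d j\<bar> \<in> {2 * m - 2, 2 * m + 2}" if "i < ?n" for i
      proof -
        have "{2 * \<bar>A\<bar>, 2 * \<bar>B + 1\<bar>, 2 * \<bar>B - 1\<bar>} \<subseteq> {2 * m - 2, 2 * m + 2}"
          using h m(1) by (auto simp: abs_if split: if_splits)
        then show ?thesis using val[OF that] by blast
      qed
      show "int ?n * (2 * m + 1) * (2 * m - 2 + (2 * m + 2)) = int ?n * (int ?n + (2 * m - 2) * (2 * m + 2))"
        unfolding n by (simp add: power2_eq_square algebra_simps)
    qed (use m(1) E E' in auto)
  qed
  then show ?thesis unfolding max_excess_def excess_bound_eq[OF m(1) n] .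
qed

end

section \<open>Choice of a generator and conclusion\<close>

lemma field_paley_field:
  assumes "field F" "card (carrier F) = q" "q mod 4 = 1"
  shows "\<exists>g. paley_field F q g"
proof -
  interpret field F by fact
  \<comment> \<open>An infinite set has \<open>card\<close> 0, contrary to
    \<open>q mod 4 = 1\<close>.\<close>
  have fin: "finite (carrier F)" using assms by (metis card.infinite mod_0 zero_neq_one)
  obtain g where g: "g \<in> carrier F - {\<zero>\<^bsub>F\<^esub>}" "carrier F - {\<zero>\<^bsub>F\<^esub>} = {g [^]\<^bsub>F\<^esub> i | i :: nat. i \<in> UNIV}"
    using finite_field_mult_group_has_gen[OF fin] by auto
  then have "carrier F - {\<zero>\<^bsub>F\<^esub>} = range (\<lambda>j::nat. g [^]\<^bsub>F\<^esub> j)" by auto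
  then have "paley_field F q g"
    using g(1) fin assms by unfold_locales auto
  then show ?thesis by blast
qed

theorem theorem1p3:
  fixes m :: int and q n :: nat
  assumes "int q = 2 * m\<^sup>2 + 2 * m + 1"
    and "primepow q"
    and "n = 2 * q + 2"
  shows "int n = 4 * (m\<^sup>2 + m + 1)
    \<and> (\<exists>H. hadamard_mat n H \<and> biregular H \<and> max_excess n H)
    \<and> (\<forall>(F :: ('a, 'b) ring_scheme) e.
          field F \<and> card (carrier F) = q \<and> bij_betw e {0..<q} (carrier F) \<longrightarrow>
            hadamard_mat n (paley_hadamard F q e) \<and>
            (\<exists>R C. R \<subseteq> {0..<n} \<and> C \<subseteq> {0..<n} \<and>
               (let H' = negate_rows_cols R C (paley_hadamard F q e)
                in hadamard_mat n H' \<and> biregular H' \<and> max_excess n H')))"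
proof -
  obtain p k where p: "prime p" "k > 0" "q = p ^ k"
    using assms(2) by (auto simp: primepow_def)
  have q1: "q > 1" using assms(2) by (rule primepow_gt_Suc_0[unfolded One_nat_def[symmetric]])
  \<comment> \<open>The polynomial \<open>2m^2 + 2m + 1\<close> is invariant under
    \<open>m \<mapsto> - 1 - m\<close>, so a nonnegative parameter suffices; it is not 0 because
    \<open>q > 1\<close>.\<close>
  define m' where "m' = (if m \<ge> 0 then m else - 1 - m)"
  have m': "m' \<ge> 1" "int q = 2 * m'\<^sup>2 + 2 * m' + 1"
  proof -
    show eq: "int q = 2 * m'\<^sup>2 + 2 * m' + 1"
      using assms(1) by (auto simp: m'_def power2_eq_square algebra_simps)
    have "m' \<noteq> 0" using eq q1 by auto
    then show "m' \<ge> 1" by (auto simp: m'_def split: if_splits)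
  qed
  have q4: "q mod 4 = 1"
  proof -
    have "even (m' * (m' + 1))" by simp
    then obtain j where "m' * (m' + 1) = 2 * j" by (elim evenE)
    then have "int q = 4 * j + 1" using m'(2) by (simp add: power2_eq_square algebra_simps)
    then show ?thesis by presburger
  qed
  \<comment> \<open>Stated with fresh type variables, since it is applied both to arbitrary fields
    of the given type and to the concrete field that witnesses existence.\<close>
  have main: "hadamard_mat n (paley_hadamard F q e) \<and>
            (\<exists>R C. R \<subseteq> {0..<n} \<and> C \<subseteq> {0..<n} \<and>
               (let H' = negate_rows_cols R C (paley_hadamard F q e)
                in hadamard_mat n H' \<and> biregular H' \<and> max_excess n H'))"
    if F: "field F" "card (carrier F) = q" "bij_betw e {0..<q} (carrier F)"
    for F :: "('c, 'd) ring_scheme" and e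
  proof -
    obtain g where "paley_field F q g" using field_paley_field[OF F(1,2) q4] by blast
    then interpret paley_field F q g .
    show ?thesis unfolding assms(3)
      using hadamard_paley[OF F(3)] paley_max_excess[OF F(3) m' p(1,3)] by blast
  qed
  have "\<exists>H. hadamard_mat n H \<and> biregular H \<and> max_excess n H"
  proof -
    obtain F :: "((int list \<times> nat) multiset \<Rightarrow> int) ring" where F: "field F" "card (carrier F) = q"
      using exists_finite_field[OF p(1,2)] p(3) by blast
    have "finite (carrier F)" using F(2) q1 by (metis card.infinite not_one_less_zero)
    then obtain e where "bij_betw e {0..<q} (carrier F)"
      using ex_bij_betw_nat_finite F(2) by blast
    from main[OF F this] show ?thesis unfolding Let_def by blast
  qed
  moreover have "int n = 4 * (m\<^sup>2 + m + 1)" using assms(1,3) by simp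
  ultimately show ?thesis using main by blast
qed

end
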